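(* For every dominant state $s\in\mathcal D_C$ and every nonempty target subset $D\subseteq\mathcal D_C\setminus\{s\}$ of dominant states different from $s$, $$\lim_{\nu\to\infty}\log_\nu\mathbb E\,\tau_{s,D}(\nu)=\Delta(s,D)-1 .$$
   Context: Let $V=\{1,\dots,N\}$ be a finite set of nodes and $C\ge1$ the number of channels. For each $c\in\{1,\dots,C\}$ let $G_c=(V,E_c)$ be a simple undirected graph (the conflict graphs may differ for different $c$). The set of feasible states is $$\mathcal X_C=\{x\in\{0,1,\dots,C\}^N:\ \text{for every } c\in\{1,\dots,C\}\text{ and every }(i,j)\in E_c,\ \text{not both } x_i=c\text{ and }x_j=c\}.$$ For a parameter $\nu>1$, $\{X_C(t)\}_{t\ge0}$ is the continuous-time Markov process on $\mathcal X_C$ with homogeneous transition rates, for $x\neq y$: $q_C(x,y)=\nu$ if $x_i=0$ and $y=x+c\,e_i$ for some $i\in V$, $1\le c\le C$; $q_C(x,y)=1$ if $x_i=c\ge 1$ and $y=x-c\,e_i$ for some $i\in V$, $1\le c\le C$; $q_C(x,y)=0$ otherwise ($e_i$ is the $i$-th unit vector). For $x\in\mathcal X_C$, $a(x)=\sum_{i=1}^N\mathbf 1_{\{x_i\ne0\}}$; $\mathcal A(C)=\max_{x\in\mathcal X_C}a(x)$; the set of dominant states is $\mathcal D_C=\{x\in\mathcal X_C:a(x)=\mathcal A(C)\}$. $\tau_{x,A}(\nu)=\inf\{t>0:X_C(t)\in A\}$ is the first hitting time of $A\subset\mathcal X_C$ for the process started at $X_C(0)=x$. A path $\omega:x\to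 y$ is a finite sequence $\omega_1,\dots,\omega_n\in\mathcal X_C$ with $\omega_1=x$, $\omega_n=y$ and $q_C(\omega_k,\omega_{k+1})>0$ for $k=1,\dots,n-1$. The communication height is $$\Delta(x,y)=\min_{\omega:x\to y}\ \max_{z\in\omega}\,(\mathcal A(C)-a(z)),$$ and for a nonempty set $A\subset\mathcal X_C$, $\Delta(x,A)=\min_{y\in A}\Delta(x,y)$ (i.e. the minimum over all paths from $x$ to some element of $A$). $\log_\nu$ denotes logarithm in base $\nu$. *)

theory Defs
  imports "HOL-Probability.Probability"
begin

section \<open>Continuous-time Markov processes on a finite state space\<close>

text \<open>
  Off-diagonal rates determine the process: only \<open>q x y\<close> with \<open>x \<noteq> y\<close> is used.  The diagonal of
  the generator is implied, since the rows of \<open>P h\<close> sum to 1.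
\<close>

definition transition_semigroup ::
    "'s set \<Rightarrow> ('s \<Rightarrow> 's \<Rightarrow> real) \<Rightarrow> (real \<Rightarrow> 's \<Rightarrow> 's \<Rightarrow> real) \<Rightarrow> bool" where
  "transition_semigroup S q P \<longleftrightarrow>
     (\<forall>h\<ge>0. \<forall>x\<in>S. (\<forall>y\<in>S. 0 \<le> P h x y) \<and> (\<Sum>y\<in>S. P h x y) = 1) \<and>
     (\<forall>x\<in>S. \<forall>y\<in>S. P 0 x y = (if x = y then 1 else 0)) \<and>
     (\<forall>g\<ge>0. \<forall>h\<ge>0. \<forall>x\<in>S. \<forall>z\<in>S. P (g + h) x z = (\<Sum>y\<in>S. P g x y * P h y z)) \<and>
     (\<forall>x\<in>S. \<forall>y\<in>S. x \<noteq> y \<longrightarrow> ((\<lambda>h. P h x y / h) \<longlongrightarrow> q x y) (at_right 0))"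

text \<open>
  The Markov property is stated through finite-dimensional distributions, multiplied out so that
  conditioning on null events needs no convention.  Right-continuity is with respect to the
  discrete topology on \<open>S\<close>; it makes the distribution
  of a hitting time determined by the finite-dimensional distributions.
\<close>

locale markov_jump_process = prob_space M
  for M :: "'w measure" and X :: "real \<Rightarrow> 'w \<Rightarrow> 's" and S :: "'s set" and q :: "'s \<Rightarrow> 's \<Rightarrow> real" +
  assumes finite_state_space: "finite S"
    and random_state: "\<And>t. 0 \<le> t \<Longrightarrow> X t \<in> M \<rightarrow>\<^sub>M count_space S"
    and right_continuous:
      "\<And>\<omega> t. \<omega> \<in> space M \<Longrightarrow> 0 \<le> t \<Longrightarrow> \<forall>\<^sub>F u in at_right t. X u \<omega> = X t \<omega>"
    and markov_property: "\<exists>P. transition_semigroup S q P \<and>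
      (\<forall>n (t :: nat \<Rightarrow> real) x.
         0 \<le> t 0 \<and> (\<forall>k\<le>n. t k < t (Suc k)) \<and> (\<forall>k\<le>Suc n. x k \<in> S) \<longrightarrow>
         measure M {\<omega> \<in> space M. \<forall>k\<le>Suc n. X (t k) \<omega> = x k} =
         measure M {\<omega> \<in> space M. \<forall>k\<le>n. X (t k) \<omega> = x k} *
           P (t (Suc n) - t n) (x n) (x (Suc n)))"

text \<open>The infimum is taken in \<^typ>\<open>ennreal\<close>, hence is \<open>\<infinity>\<close> if the set is never reached.\<close>

definition hitting_time :: "(real \<Rightarrow> 'w \<Rightarrow> 's) \<Rightarrow> 's set \<Rightarrow> 'w \<Rightarrow> ennreal" where
  "hitting_time X A \<omega> = (INF t\<in>{t. 0 < t \<and> X t \<omega> \<in> A}. ennreal t)"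


section \<open>Multi-channel activity states on conflict graphs\<close>

definition simple_graph_on :: "'v set \<Rightarrow> ('v \<times> 'v) set \<Rightarrow> bool" where
  "simple_graph_on V E \<longleftrightarrow> E \<subseteq> V \<times> V \<and> sym E \<and> irrefl E"

text \<open>
  States are functions on the node set \<open>{1..N}\<close>, extended by \<^const>\<open>undefined\<close> elsewhere so that
  equality of states is equality of functions.
\<close>

definition states :: "nat \<Rightarrow> nat \<Rightarrow> (nat \<Rightarrow> (nat \<times> nat) set) \<Rightarrow> (nat \<Rightarrow> nat) set" where
  "states N C E = {x \<in> {1..N} \<rightarrow>\<^sub>E {0..C}.
     \<forall>c\<in>{1..C}. \<forall>(i, j)\<in>E c. \<not> (x i = c \<and> x j = c)}"

definition rate :: "nat \<Rightarrow> nat \<Rightarrow> real \<Rightarrow> (nat \<Rightarrow> nat) \<Rightarrow> (nat \<Rightarrow> nat) \<Rightarrow> real" where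
  "rate N C \<nu> x y =
     (if \<exists>i\<in>{1..N}. \<exists>c\<in>{1..C}. x i = 0 \<and> y = x(i := x i + c) then \<nu>
      else if \<exists>i\<in>{1..N}. \<exists>c\<in>{1..C}. x i = c \<and> y = x(i := x i - c) then 1
      else 0)"

lemma rate_pos_iff:
  assumes "1 < \<nu>" "1 < \<mu>"
  shows "0 < rate N C \<nu> x y \<longleftrightarrow> 0 < rate N C \<mu> x y"
proof -
  have "0 < (if a then \<nu> else if b then 1 else 0) \<longleftrightarrow> 0 < (if a then \<mu> else if b then 1 else 0)" for a b
    using assms by simp
  then show ?thesis
    unfolding rate_def .
qed

definition active :: "nat \<Rightarrow> (nat \<Rightarrow> nat) \<Rightarrow> nat" where
  "active N x = (\<Sum>i\<in>{1..N}. if x i \<noteq> 0 then 1 else 0)"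

definition max_active :: "nat \<Rightarrow> nat \<Rightarrow> (nat \<Rightarrow> (nat \<times> nat) set) \<Rightarrow> nat" where
  "max_active N C E = Max (active N ` states N C E)"

definition dominant :: "nat \<Rightarrow> nat \<Rightarrow> (nat \<Rightarrow> (nat \<times> nat) set) \<Rightarrow> (nat \<Rightarrow> nat) set" where
  "dominant N C E = {x \<in> states N C E. active N x = max_active N C E}"

text \<open>
  Whether a rate is positive does not depend on \<open>\<nu> > 1\<close> (see \<open>rate_pos_iff\<close>), so paths need
  not carry \<open>\<nu>\<close>.
\<close>

definition paths :: "nat \<Rightarrow> nat \<Rightarrow> (nat \<Rightarrow> (nat \<times> nat) set) \<Rightarrow>
    (nat \<Rightarrow> nat) \<Rightarrow> (nat \<Rightarrow> nat) \<Rightarrow> (nat \<Rightarrow> nat) list set" where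
  "paths N C E x y = {\<omega>. \<omega> \<noteq> [] \<and> set \<omega> \<subseteq> states N C E \<and> hd \<omega> = x \<and> last \<omega> = y \<and>
     successively (\<lambda>u v. \<forall>\<nu>>1. 0 < rate N C \<nu> u v) \<omega>}"

text \<open>
  Subtraction on \<^typ>\<open>nat\<close> does not truncate here, as \<open>active N z \<le> max_active N C E\<close> for every
  state \<open>z\<close> of a path.
\<close>

definition comm_height :: "nat \<Rightarrow> nat \<Rightarrow> (nat \<Rightarrow> (nat \<times> nat) set) \<Rightarrow>
    (nat \<Rightarrow> nat) \<Rightarrow> (nat \<Rightarrow> nat) \<Rightarrow> nat" where
  "comm_height N C E x y =
     Min ((\<lambda>\<omega>. Max ((\<lambda>z. max_active N C E - active N z) ` set \<omega>)) ` paths N C E x y)"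

definition comm_height_set :: "nat \<Rightarrow> nat \<Rightarrow> (nat \<Rightarrow> (nat \<times> nat) set) \<Rightarrow>
    (nat \<Rightarrow> nat) \<Rightarrow> (nat \<Rightarrow> nat) set \<Rightarrow> nat" where
  "comm_height_set N C E x A = Min (comm_height N C E x ` A)"

end

(*
  The mean hitting time of D is the solution h of L h = -1 off D, h = 0 on D, where L is the
  generator; this is seen by observing the process on the grid of mesh 2^-n, where the mean
  decrease of h per step off D lies between 1 - \<epsilon> and 1 + \<epsilon> times the mesh, and letting n tend to
  infinity.

  The process is reversible with respect to the weights w x = \<nu> ^ active x, so w s * h s is the sum
  of w x * g x, where g is the Green function with pole s killed on D.  As 0 \<le> g \<le> g s and s has
  maximal weight, h s agrees with g s up to a constant factor, and g s is w s divided by the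
  effective conductance between s and D.  A path of least height bounds that conductance from
  below, and the indicator of the component of s below the communication height \<Delta> bounds it from
  above; both bounds are constant multiples of \<nu> ^ (max_active - \<Delta> + 1).
*)

theory Submission
  imports Defs "HOL-Real_Asymp.Real_Asymp" "Jordan_Normal_Form.Determinant"
begin

section \<open>Finite linear systems\<close>

text \<open>The process is given only by its finite-dimensional distributions and right-continuity;
  no jump times, embedded chain or strong Markov property is assumed. A grid needs none of these:
  events at finitely many times are computed from the semigroup, and right-continuity turns a hit at
  an arbitrary time into hits on all fine grids. Dyadic meshes make the grids nested, so the grid
  hitting times decrease and monotone convergence applies. Since \<open>h\<close> comes from linear
  algebra and not from an expectation, finiteness of the mean is a conclusion.

  All estimates may lose factors that depend on the number of states and on the length of one fixed
  path, but not on \<nu>: such factors vanish under the logarithm in base \<nu>. The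
  \<open>- 1\<close> in the limit arises because the conductance of an edge is the weight of its
  busier endpoint, one power of \<nu> above the weight of the lower one.\<close>

lemma finite_linear_system_solvable:
  fixes A :: "'a \<Rightarrow> 'a \<Rightarrow> real"
  assumes "finite I"
    and kernel: "\<And>f. (\<And>x. x \<in> I \<Longrightarrow> (\<Sum>y\<in>I. A x y * f y) = 0) \<Longrightarrow> (\<And>x. x \<in> I \<Longrightarrow> f x = 0)"
  obtains f where "\<And>x. x \<in> I \<Longrightarrow> (\<Sum>y\<in>I. A x y * f y) = b x"
proof -
  define n where "n = card I"
  obtain e where e: "bij_betw e {0..<n} I"
    using ex_bij_betw_nat_finite[OF \<open>finite I\<close>] unfolding n_def by blast
  define e' where "e' = the_inv_into {0..<n} e"
  have e'_in: "e' x \<in> {0..<n}" if "x \<in> I" for x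
    using bij_betwE[OF bij_betw_the_inv_into[OF e]] that by (simp add: e'_def)
  have ee': "e (e' x) = x" if "x \<in> I" for x
    using f_the_inv_into_f_bij_betw[OF e] that by (simp add: e'_def)
  have e'e: "e' (e i) = i" if "i < n" for i
    using the_inv_into_f_f[of e "{0..<n}" i] e that by (simp add: e'_def bij_betw_def)
  have e_in: "e i \<in> I" if "i < n" for i
    using bij_betwE[OF e] that by auto
  define B where "B = mat n n (\<lambda>(i, j). A (e i) (e j))"
  have B: "B \<in> carrier_mat n n"
    by (simp add: B_def)
  have B_mult: "(B *\<^sub>v v) $ i = (\<Sum>y\<in>I. A (e i) y * v $ e' y)"
    if "v \<in> carrier_vec n" "i < n" for v i
  proof -
    have "(B *\<^sub>v v) $ i = (\<Sum>j\<in>{0..<n}. A (e i) (e j) * v $ j)"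
      using that by (simp add: B_def scalar_prod_def)
    also have "\<dots> = (\<Sum>j\<in>{0..<n}. A (e i) (e j) * v $ e' (e j))"
      by (intro sum.cong) (simp_all add: e'e)
    also have "\<dots> = (\<Sum>y\<in>I. A (e i) y * v $ e' y)"
      using sum.reindex_bij_betw[OF e, of "\<lambda>y. A (e i) y * v $ e' y"] .
    finally show ?thesis .
  qed
  have det: "det B \<noteq> 0"
  proof
    assume "det B = 0"
    then obtain v where v: "v \<in> carrier_vec n" "v \<noteq> 0\<^sub>v n" "B *\<^sub>v v = 0\<^sub>v n"
      using det_0_iff_vec_prod_zero_field[OF B] by blast
    have "(\<Sum>y\<in>I. A x y * v $ e' y) = 0" if "x \<in> I" for x
      using B_mult[OF v(1), of "e' x"] v(3) e'_in[OF that] ee'[OF that] by simp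
    then have zero: "v $ e' x = 0" if "x \<in> I" for x
      using kernel[of "\<lambda>y. v $ e' y"] that by blast
    have "v $ i = 0" if "i < n" for i
      using zero[OF e_in[OF that]] e'e[OF that] by simp
    then have "v = 0\<^sub>v n"
      using v(1) by (intro eq_vecI) auto
    then show False
      using v(2) by simp
  qed
  \<comment> \<open>The trivial kernel made \<open>det B\<close> nonzero, so the adjugate divided by
    the determinant inverts \<open>B\<close>.\<close>
  define v where "v = (1 / det B) \<cdot>\<^sub>v (adj_mat B *\<^sub>v vec n (\<lambda>i. b (e i)))"
  have adj: "adj_mat B \<in> carrier_mat n n" "B * adj_mat B = det B \<cdot>\<^sub>m 1\<^sub>m n"
    using adj_mat[OF B] by blast+
  have v: "v \<in> carrier_vec n"
    using adj by (simp add: v_def)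
  have "B *\<^sub>v v = (1 / det B) \<cdot>\<^sub>v (B *\<^sub>v (adj_mat B *\<^sub>v vec n (\<lambda>i. b (e i))))"
    unfolding v_def using B adj(1) by (intro mult_mat_vec) auto
  also have "B *\<^sub>v (adj_mat B *\<^sub>v vec n (\<lambda>i. b (e i))) = (det B \<cdot>\<^sub>m 1\<^sub>m n) *\<^sub>v vec n (\<lambda>i. b (e i))"
    using assoc_mult_mat_vec[OF B adj(1), of "vec n (\<lambda>i. b (e i))"] adj(2) by simp
  also have "\<dots> = det B \<cdot>\<^sub>v vec n (\<lambda>i. b (e i))"
    by (intro eq_vecI) (auto simp: scalar_prod_def sum.delta if_distrib if_distribR cong: if_cong)
  finally have Bv: "B *\<^sub>v v = vec n (\<lambda>i. b (e i))"
    using det by (simp add: smult_smult_assoc)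
  show thesis
  proof (rule that[of "\<lambda>y. v $ e' y"])
    fix x assume "x \<in> I"
    then show "(\<Sum>y\<in>I. A x y * v $ e' y) = b x"
      using B_mult[OF v, of "e' x"] Bv e'_in[of x] ee'[of x] by simp
  qed
qed

section \<open>Reversible rates on a finite set\<close>

locale reversible_rates =
  fixes S :: "'a set" and q :: "'a \<Rightarrow> 'a \<Rightarrow> real" and w :: "'a \<Rightarrow> real"
  assumes finite_states: "finite S"
    and rate_nonneg: "x \<in> S \<Longrightarrow> y \<in> S \<Longrightarrow> 0 \<le> q x y"
    and weight_pos: "x \<in> S \<Longrightarrow> 0 < w x"
    and detailed_balance: "x \<in> S \<Longrightarrow> y \<in> S \<Longrightarrow> w x * q x y = w y * q y x"
    and irreducible: "x \<in> S \<Longrightarrow> y \<in> S \<Longrightarrow> (x, y) \<in> {(u, v). u \<in> S \<and> v \<in> S \<and> 0 < q u v}\<^sup>*"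
begin

section \<open>Generator, Dirichlet form and summation by parts\<close>

definition gen :: "('a \<Rightarrow> real) \<Rightarrow> 'a \<Rightarrow> real" where
  "gen f x = (\<Sum>y\<in>S. q x y * (f y - f x))"

text \<open>The Dirichlet form of the network with conductances \<open>w x * q x y\<close>. The
  double sum meets every edge in both orientations, whence the division by 2.\<close>

definition energy :: "('a \<Rightarrow> real) \<Rightarrow> ('a \<Rightarrow> real) \<Rightarrow> real" where
  "energy f g = (\<Sum>x\<in>S. \<Sum>y\<in>S. w x * q x y * ((f x - f y) * (g x - g y))) / 2"

lemma conductance_nonneg: "x \<in> S \<Longrightarrow> y \<in> S \<Longrightarrow> 0 \<le> w x * q x y"
  using rate_nonneg weight_pos by (simp add: less_imp_le)

lemma energy_commute: "energy f g = energy g f"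
  by (simp add: energy_def mult.commute)

text \<open>Summation by parts: detailed balance makes the conductances symmetric, so exchanging
  \<open>x\<close> and \<open>y\<close> identifies the two halves of the expanded product.\<close>

lemma energy_eq_gen: "energy f g = (\<Sum>x\<in>S. w x * f x * (- gen g x))"
proof -
  let ?T = "\<lambda>x y. w x * q x y * (f x * (g x - g y))"
  have "(\<Sum>x\<in>S. \<Sum>y\<in>S. ?T x y) = (\<Sum>y\<in>S. \<Sum>x\<in>S. ?T x y)"
    by (rule sum.swap)
  also have "\<dots> = (\<Sum>x\<in>S. \<Sum>y\<in>S. w x * q x y * (f y * (g y - g x)))"
    by (intro sum.cong refl) (simp add: detailed_balance)
  finally have swap: "(\<Sum>x\<in>S. \<Sum>y\<in>S. ?T x y) =
      (\<Sum>x\<in>S. \<Sum>y\<in>S. w x * q x y * (f y * (g y - g x)))" .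
  have "2 * energy f g = (\<Sum>x\<in>S. \<Sum>y\<in>S. ?T x y) +
      (\<Sum>x\<in>S. \<Sum>y\<in>S. w x * q x y * (f y * (g y - g x)))"
    unfolding energy_def sum.distrib[symmetric]
    by (simp, intro sum.cong refl) (simp add: algebra_simps)
  then have "energy f g = (\<Sum>x\<in>S. \<Sum>y\<in>S. ?T x y)"
    using swap by simp
  also have "\<dots> = (\<Sum>x\<in>S. w x * f x * (- gen g x))"
    unfolding gen_def sum_negf[symmetric] sum_distrib_left
    by (intro sum.cong refl) (simp add: algebra_simps)
  finally show ?thesis .
qed

text \<open>Twice the energy is the inner product over ordered pairs of the gradients, each scaled
  by the square root of the conductance.\<close>

lemma energy_Cauchy_Schwarz: "(energy f g)\<^sup>2 \<le> energy f f * energy g g"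
proof -
  let ?a = "\<lambda>f (x, y). sqrt (w x * q x y) * (f x - f y)"
  have eq: "2 * energy f g = (\<Sum>p\<in>S \<times> S. ?a f p * ?a g p)" for f g
    unfolding energy_def sum.cartesian_product
    using conductance_nonneg
    by (simp, intro sum.cong) (auto simp: algebra_simps simp flip: real_sqrt_mult)
  have "(2 * energy f g)\<^sup>2 \<le> (2 * energy f f) * (2 * energy g g)"
    using Cauchy_Schwarz_ineq_sum[of "?a f" "?a g" "S \<times> S"] unfolding eq by (simp add: power2_eq_square)
  then show ?thesis
    by (simp add: power_mult_distrib)
qed

lemma energy_edge_le:
  assumes "x \<in> S" "y \<in> S"
  shows "w x * q x y * (f x - f y)\<^sup>2 \<le> 2 * energy f f"
proof -
  let ?T = "\<lambda>x y. w x * q x y * ((f x - f y) * (f x - f y))"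
  have nonneg: "0 \<le> ?T u v" if "u \<in> S" "v \<in> S" for u v
    using conductance_nonneg[OF that] by simp
  have "?T x y \<le> (\<Sum>y\<in>S. ?T x y)"
    using assms nonneg finite_states by (intro member_le_sum) auto
  also have "\<dots> \<le> (\<Sum>x\<in>S. \<Sum>y\<in>S. ?T x y)"
    using assms nonneg finite_states by (intro member_le_sum) (auto intro!: sum_nonneg)
  finally show ?thesis
    by (simp add: energy_def power2_eq_square)
qed

lemma energy_nonneg: "0 \<le> energy f f"
  unfolding energy_def using conductance_nonneg by (auto intro!: sum_nonneg)

text \<open>Each edge of conductance at least \<open>k\<close> allows a difference of at most
  \<open>sqrt (2 * energy f f / k)\<close>, and the differences telescope. The length counts
  vertices and so exceeds the number of edges by one, a harmless loss.\<close>

lemma path_difference_le: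
  assumes "0 < k" "p \<noteq> []" "set p \<subseteq> S" "successively (\<lambda>u v. k \<le> w u * q u v) p"
  shows "\<bar>f (hd p) - f (last p)\<bar> \<le> real (length p) * sqrt (2 * energy f f / k)"
  using assms(2-)
proof (induction p rule: list_nonempty_induct)
  case (single x)
  then show ?case
    using energy_nonneg \<open>0 < k\<close> by simp
next
  case (cons x xs)
  let ?y = "hd xs"
  have y: "x \<in> S" "?y \<in> S" "k \<le> w x * q x ?y"
    using cons by (auto simp: successively_Cons)
  have "k * (f x - f ?y)\<^sup>2 \<le> w x * q x ?y * (f x - f ?y)\<^sup>2"
    using y by (intro mult_right_mono) auto
  also have "\<dots> \<le> 2 * energy f f"
    using y by (intro energy_edge_le)
  finally have "(f x - f ?y)\<^sup>2 \<le> 2 * energy f f / k"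
    using \<open>0 < k\<close> by (simp add: field_simps)
  then have "\<bar>f x - f ?y\<bar> \<le> sqrt (2 * energy f f / k)"
    using real_le_rsqrt[of "\<bar>f x - f ?y\<bar>"] by simp
  moreover have "\<bar>f ?y - f (last xs)\<bar> \<le> real (length xs) * sqrt (2 * energy f f / k)"
    using cons by (auto simp: successively_Cons)
  ultimately show ?case
    using cons(1) by (simp add: algebra_simps)
qed

section \<open>Minimum principle, boundary value problems and the Green function\<close>

text \<open>A negative minimum cannot lie in \<open>B\<close>. Off \<open>B\<close>,
  \<open>gen f \<le> 0\<close> forces every neighbour of a minimiser to be a minimiser too, and
  irreducibility carries this into the nonempty set \<open>B\<close>.\<close>

lemma minimum_principle:
  assumes "B \<noteq> {}" "B \<subseteq> S" and boundary: "\<And>x. x \<in> B \<Longrightarrow> 0 \<le> f x"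
    and super: "\<And>x. x \<in> S - B \<Longrightarrow> gen f x \<le> 0"
    and "x \<in> S"
  shows "0 \<le> f x"
proof (rule ccontr)
  assume neg: "\<not> 0 \<le> f x"
  define m where "m = Min (f ` S)"
  have m_le: "m \<le> f y" if "y \<in> S" for y
    using finite_states that by (simp add: m_def)
  have "m \<in> f ` S"
    unfolding m_def using finite_states \<open>x \<in> S\<close> by (intro Min_in) auto
  then obtain z where z: "z \<in> S" "f z = m"
    by auto
  have "m < 0"
    using m_le[OF \<open>x \<in> S\<close>] neg by simp
  obtain b where b: "b \<in> B"
    using \<open>B \<noteq> {}\<close> by blast
  have step: "f v = m" if "u \<in> S" "v \<in> S" "0 < q u v" "f u = m" for u v
  proof -
    have "u \<notin> B"
      using boundary[of u] that(4) \<open>m < 0\<close> by auto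
    have nonneg: "\<And>y. y \<in> S \<Longrightarrow> 0 \<le> q u y * (f y - f u)"
      using rate_nonneg[OF \<open>u \<in> S\<close>] m_le that(4) by simp
    then have "0 \<le> gen f u"
      unfolding gen_def by (rule sum_nonneg)
    then have "gen f u = 0"
      using super[of u] \<open>u \<notin> B\<close> \<open>u \<in> S\<close> by simp
    then have "q u v * (f v - f u) = 0"
      using nonneg finite_states \<open>v \<in> S\<close> by (simp add: gen_def sum_nonneg_eq_0_iff)
    then show ?thesis
      using that by simp
  qed
  have "(z, b) \<in> {(u, v). u \<in> S \<and> v \<in> S \<and> 0 < q u v}\<^sup>*"
    using z b \<open>B \<subseteq> S\<close> by (intro irreducible) auto
  then have "f b = m"
    by (induction rule: rtrancl_induct) (use z step in auto)
  then show False
    using boundary[OF b] \<open>m < 0\<close> by simp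
qed

text \<open>Existence follows from uniqueness because the system is square and finite. Uniqueness is
  the minimum principle applied to both \<open>f\<close> and \<open>- f\<close>.\<close>

lemma poisson_solvable:
  assumes "B \<noteq> {}" "B \<subseteq> S"
  obtains f where "\<And>x. x \<in> B \<Longrightarrow> f x = 0" "\<And>x. x \<in> S - B \<Longrightarrow> gen f x = - r x"
proof -
  \<comment> \<open>Rows in \<open>B\<close> are those of the identity and encode the boundary
    values; the other rows are those of the generator, whose diagonal is minus the total
    rate.\<close>
  define A where "A x y =
    (if x \<in> B then if y = x then 1 else 0 else q x y - (if y = x then \<Sum>z\<in>S. q x z else 0))" for x y
  have A_boundary: "(\<Sum>y\<in>S. A x y * f y) = f x" if "x \<in> B" for x f
    using that assms finite_states by (auto simp: A_def if_distrib[of "\<lambda>c. c * _"] sum.delta cong: if_cong)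
  have A_gen: "(\<Sum>y\<in>S. A x y * f y) = gen f x" if "x \<in> S - B" for x f
  proof -
    have "(\<Sum>y\<in>S. A x y * f y) =
        (\<Sum>y\<in>S. q x y * f y - (if y = x then (\<Sum>z\<in>S. q x z) * f x else 0))"
      using that by (intro sum.cong) (auto simp: A_def algebra_simps)
    also have "\<dots> = gen f x"
      using that finite_states
      by (simp add: sum_subtractf gen_def right_diff_distrib sum_distrib_right)
    finally show ?thesis .
  qed
  have kernel: "f x = 0" if *: "\<And>x. x \<in> S \<Longrightarrow> (\<Sum>y\<in>S. A x y * f y) = 0" and "x \<in> S" for f x
  proof -
    have B0: "f x = 0" if "x \<in> B" for x
      using *[of x] A_boundary[OF that, of f] that assms by auto
    have gen0: "gen f x = 0" if "x \<in> S - B" for x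
      using *[of x] A_gen[OF that, of f] that by auto
    have "gen (\<lambda>x. - f x) x = 0" if "x \<in> S - B" for x
    proof -
      have "gen (\<lambda>x. - f x) x = - gen f x"
        unfolding gen_def sum_negf[symmetric] by (intro sum.cong) (auto simp: algebra_simps)
      then show ?thesis
        using gen0[OF that] by simp
    qed
    then have "0 \<le> - f x"
      using B0 \<open>x \<in> S\<close> by - (rule minimum_principle[OF assms, of "\<lambda>x. - f x"], auto)
    moreover have "0 \<le> f x"
      using B0 gen0 \<open>x \<in> S\<close> by - (rule minimum_principle[OF assms, of f], auto)
    ultimately show ?thesis
      by simp
  qed
  obtain f where f: "\<And>x. x \<in> S \<Longrightarrow> (\<Sum>y\<in>S. A x y * f y) = (if x \<in> B then 0 else - r x)"
    by (rule finite_linear_system_solvable[OF finite_states, of A "\<lambda>x. if x \<in> B then 0 else - r x"])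
      (use kernel in blast)+
  show thesis
  proof (rule that[of f])
    show "f x = 0" if "x \<in> B" for x
      using f[of x] A_boundary[OF that, of f] that assms by auto
    show "gen f x = - r x" if "x \<in> S - B" for x
      using f[of x] A_gen[OF that, of f] that by auto
  qed
qed

text \<open>\<open>g\<close> solves \<open>- gen g = 1\<close> at \<open>s\<close>, is harmonic at
  the other states off \<open>B\<close>, and vanishes on \<open>B\<close>. The last property is its
  reproducing property for the Dirichlet form; with \<open>f = g\<close> it evaluates the energy of
  \<open>g\<close> as \<open>w s * g s\<close>.\<close>

lemma green_function:
  assumes "B \<noteq> {}" "B \<subseteq> S" "s \<in> S - B"
  obtains g where "\<And>x. x \<in> B \<Longrightarrow> g x = 0"
    "\<And>x. x \<in> S \<Longrightarrow> 0 \<le> g x" "\<And>x. x \<in> S \<Longrightarrow> g x \<le> g s"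
    "\<And>f. (\<And>x. x \<in> B \<Longrightarrow> f x = 0) \<Longrightarrow> energy f g = w s * f s"
proof -
  obtain g where gB: "\<And>x. x \<in> B \<Longrightarrow> g x = 0"
    and gen: "\<And>x. x \<in> S - B \<Longrightarrow> gen g x = - (if x = s then 1 else 0)"
    using poisson_solvable[OF assms(1,2), of "\<lambda>x. if x = s then 1 else 0"] by blast
  have nonneg: "0 \<le> g x" if "x \<in> S" for x
    using that gB gen by - (rule minimum_principle[OF assms(1,2), of g], auto)
  \<comment> \<open>The pole is moved into the boundary: off \<open>insert s B\<close> the function
    is harmonic, and on this set it equals 0 or \<open>g s\<close>.\<close>
  have "0 \<le> g s - g x" if "x \<in> S" for x
  proof (rule minimum_principle[of "insert s B"])
    show "gen (\<lambda>x. g s - g x) x \<le> 0" if "x \<in> S - insert s B" for x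
    proof -
      have "gen (\<lambda>x. g s - g x) x = - gen g x"
        unfolding gen_def sum_negf[symmetric] by (intro sum.cong) (auto simp: algebra_simps)
      then show ?thesis
        using gen[of x] that by auto
    qed
  qed (use assms that gB nonneg in auto)
  then have le: "g x \<le> g s" if "x \<in> S" for x
    using that by simp
  have "energy f g = w s * f s" if f: "\<And>x. x \<in> B \<Longrightarrow> f x = 0" for f
  proof -
    have "energy f g = (\<Sum>x\<in>S. if x = s then w s * f s else 0)"
      unfolding energy_eq_gen
    proof (intro sum.cong refl)
      fix x assume "x \<in> S"
      then show "w x * f x * - gen g x = (if x = s then w s * f s else 0)"
        using gen[of x] f[of x] \<open>s \<in> S - B\<close> by (cases "x \<in> B") auto
    qed
    also have "\<dots> = w s * f s"
      using assms finite_states by simp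
    finally show ?thesis .
  qed
  then show thesis
    using that gB nonneg le by blast
qed

section \<open>Two-sided bounds on the solution of the hitting time equation\<close>

lemma mean_hitting_time_nonneg:
  assumes "B \<noteq> {}" "B \<subseteq> S" "\<And>x. x \<in> B \<Longrightarrow> h x = 0" "\<And>x. x \<in> S - B \<Longrightarrow> gen h x = - 1" "x \<in> S"
  shows "0 \<le> h x"
  using assms by - (rule minimum_principle[of B h], auto)

context
  fixes B s h
  assumes B: "B \<noteq> {}" "B \<subseteq> S" and s: "s \<in> S - B"
    and h_boundary: "\<And>x. x \<in> B \<Longrightarrow> h x = 0"
    and h_gen: "\<And>x. x \<in> S - B \<Longrightarrow> gen h x = - 1"
begin

text \<open>Reversibility turns the mean hitting time into a stationary average of the Green function.\<close>

lemma mean_hitting_time_eq_green: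
  assumes "\<And>x. x \<in> B \<Longrightarrow> g x = 0" "\<And>f. (\<And>x. x \<in> B \<Longrightarrow> f x = 0) \<Longrightarrow> energy f g = w s * f s"
  shows "w s * h s = (\<Sum>x\<in>S. w x * g x)"
proof -
  have "w s * h s = energy h g"
    using assms(2)[OF h_boundary] by simp
  also have "\<dots> = energy g h"
    by (rule energy_commute)
  \<comment> \<open>On \<open>B\<close>, where nothing is known about \<open>gen h\<close>, the
    factor \<open>g x\<close> is 0; elsewhere \<open>- gen h x = 1\<close>.\<close>
  also have "\<dots> = (\<Sum>x\<in>S. w x * g x)"
    unfolding energy_eq_gen using assms(1) h_gen by (intro sum.cong) (simp, metis DiffI mult_zero_right mult_zero_left mult_1_right minus_minus)
  finally show ?thesis .
qed

text \<open>Along \<open>p\<close> the Green function drops from \<open>g s\<close> to 0, while its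
  energy is only linear in \<open>g s\<close>. Squaring the path estimate therefore bounds
  \<open>g s\<close> itself.\<close>

lemma mean_hitting_time_upper:
  assumes "0 < k" "p \<noteq> []" "set p \<subseteq> S" "successively (\<lambda>u v. k \<le> w u * q u v) p"
    and "hd p = s" "last p \<in> B"
    and w_le: "\<And>x. x \<in> S \<Longrightarrow> w x \<le> w s"
  shows "h s \<le> 2 * real (card S) * (real (length p))\<^sup>2 * (w s / k)"
proof -
  obtain g where gB: "\<And>x. x \<in> B \<Longrightarrow> g x = 0"
    and g: "\<And>x. x \<in> S \<Longrightarrow> 0 \<le> g x" "\<And>x. x \<in> S \<Longrightarrow> g x \<le> g s"
    and green: "\<And>f. (\<And>x. x \<in> B \<Longrightarrow> f x = 0) \<Longrightarrow> energy f g = w s * f s"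
    using green_function[OF B s] by blast
  have ws: "0 < w s"
    using weight_pos s by simp
  let ?n = "real (length p)"
  have "g s = \<bar>g (hd p) - g (last p)\<bar>"
    using gB[OF assms(6)] g(1)[of s] s assms(5) by simp
  also have "\<dots> \<le> ?n * sqrt (2 * energy g g / k)"
    using assms by (intro path_difference_le) auto
  also have "energy g g = w s * g s"
    using green gB by blast
  finally have "g s \<le> ?n * sqrt (2 * (w s * g s) / k)" .
  then have "(g s)\<^sup>2 \<le> (?n * sqrt (2 * (w s * g s) / k))\<^sup>2"
    using g(1)[of s] s by (intro power_mono) auto
  also have "\<dots> = (2 * ?n\<^sup>2 * (w s / k)) * g s"
    using g(1)[of s] s ws \<open>0 < k\<close> by (simp add: power_mult_distrib)
  \<comment> \<open>One factor \<open>g s\<close> is cancelled; the case \<open>g s = 0\<close> is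
    trivial.\<close>
  finally have gs: "g s \<le> 2 * ?n\<^sup>2 * (w s / k)"
    using g(1)[of s] s ws \<open>0 < k\<close>
    by (cases "g s = 0") (auto simp: power2_eq_square mult_le_cancel_right simp del: times_divide_eq_right)
  have "w s * h s = (\<Sum>x\<in>S. w x * g x)"
    using mean_hitting_time_eq_green gB green by blast
  \<comment> \<open>Both factors are largest at \<open>s\<close>: the weight by hypothesis
    \<open>w_le\<close>, the Green function by the minimum principle.\<close>
  also have "\<dots> \<le> (\<Sum>x\<in>S. w s * g s)"
    using g w_le weight_pos s by (intro sum_mono mult_mono) (auto simp: less_imp_le)
  finally have "h s \<le> real (card S) * g s"
    using ws by (simp add: mult.left_commute)
  also have "\<dots> \<le> real (card S) * (2 * ?n\<^sup>2 * (w s / k))"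
    using gs by (intro mult_left_mono) auto
  finally show ?thesis
    by (simp add: mult_ac)
qed

text \<open>The test function is the indicator of \<open>U\<close>.\<close>

lemma mean_hitting_time_lower:
  assumes "0 < k" "s \<in> U" "U \<inter> B = {}"
    and cut: "\<And>x y. x \<in> S \<inter> U \<Longrightarrow> y \<in> S - U \<Longrightarrow> w x * q x y \<le> k"
  shows "w s / k \<le> (real (card S))\<^sup>2 * h s"
proof -
  obtain g where gB: "\<And>x. x \<in> B \<Longrightarrow> g x = 0"
    and g: "\<And>x. x \<in> S \<Longrightarrow> 0 \<le> g x" "\<And>x. x \<in> S \<Longrightarrow> g x \<le> g s"
    and green: "\<And>f. (\<And>x. x \<in> B \<Longrightarrow> f x = 0) \<Longrightarrow> energy f g = w s * f s"
    using green_function[OF B s] by blast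
  have ws: "0 < w s"
    using weight_pos s by simp
  define \<phi> :: "'a \<Rightarrow> real" where "\<phi> = indicator U"
  \<comment> \<open>The indicator has a nonzero gradient only across the cut. Detailed balance
    reduces an edge entering \<open>U\<close> to the edge leaving it.\<close>
  have edge: "w x * q x y * ((\<phi> x - \<phi> y) * (\<phi> x - \<phi> y)) \<le> k" if "x \<in> S" "y \<in> S" for x y
    using cut[of x y] cut[of y x] detailed_balance[OF that] that \<open>0 < k\<close>
    by (auto simp: \<phi>_def indicator_def)
  have "2 * energy \<phi> \<phi> \<le> (\<Sum>x\<in>S. \<Sum>y\<in>S. k)"
    unfolding energy_def using edge by (simp del: sum_constant add: sum_mono)
  also have "\<dots> = (real (card S))\<^sup>2 * k"
    by (simp add: power2_eq_square)
  finally have e\<phi>: "energy \<phi> \<phi> \<le> (real (card S))\<^sup>2 * k"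
    using energy_nonneg[of \<phi>] by simp
  have "energy \<phi> g = w s * \<phi> s"
    using \<open>U \<inter> B = {}\<close> by (intro green) (auto simp: \<phi>_def indicator_def)
  \<comment> \<open>The reproducing property evaluates both energies that involve \<open>g\<close>,
    so Cauchy-Schwarz becomes the Dirichlet principle: the energy of a test function with value 1 at
    \<open>s\<close> and 0 on \<open>B\<close> is at least \<open>w s / g s\<close>.\<close>
  then have "(w s)\<^sup>2 = (energy \<phi> g)\<^sup>2"
    using \<open>s \<in> U\<close> by (simp add: \<phi>_def)
  also have "\<dots> \<le> energy \<phi> \<phi> * energy g g"
    by (rule energy_Cauchy_Schwarz)
  also have "\<dots> \<le> (real (card S))\<^sup>2 * k * (w s * g s)"
    using e\<phi> green[of g, OF gB] energy_nonneg[of g] \<open>0 < k\<close> by (intro mult_mono) auto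
  finally have "w s / k \<le> (real (card S))\<^sup>2 * g s"
    using ws \<open>0 < k\<close> by (simp add: field_simps power2_eq_square)
  \<comment> \<open>Of the stationary sum only the term at \<open>s\<close> is kept.\<close>
  moreover have "g s \<le> h s"
  proof -
    have "w s * g s \<le> (\<Sum>x\<in>S. w x * g x)"
      using s finite_states g(1) weight_pos
      by (intro member_le_sum) (auto intro!: mult_nonneg_nonneg simp: less_imp_le)
    also have "\<dots> = w s * h s"
      using mean_hitting_time_eq_green gB green by metis
    finally show ?thesis
      using ws by simp
  qed
  ultimately show ?thesis
    using mult_left_mono[of "g s" "h s" "(real (card S))\<^sup>2"] by simp
qed

end

end

section \<open>Mean hitting times of Markov jump processes\<close>

text \<open>As the rows of \<open>P\<close> sum to 1, \<open>h x\<close> can be subtracted inside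
  the sum. The diagonal term then vanishes, and only the prescribed off-diagonal limits are
  left.\<close>

lemma transition_semigroup_generator:
  fixes h :: "'s \<Rightarrow> real"
  assumes "transition_semigroup S q P" "x \<in> S"
  shows "((\<lambda>\<delta>. ((\<Sum>y\<in>S. P \<delta> x y * h y) - h x) / \<delta>) \<longlongrightarrow> (\<Sum>y\<in>S. q x y * (h y - h x))) (at_right 0)"
proof -
  have eq: "((\<Sum>y\<in>S. P \<delta> x y * h y) - h x) / \<delta> = (\<Sum>y\<in>S. P \<delta> x y / \<delta> * (h y - h x))" if "0 < \<delta>" for \<delta>
  proof -
    have "(\<Sum>y\<in>S. P \<delta> x y) = 1"
      using assms that by (simp add: transition_semigroup_def)
    then have "(\<Sum>y\<in>S. P \<delta> x y * h y) - h x = (\<Sum>y\<in>S. P \<delta> x y * h y) - (\<Sum>y\<in>S. P \<delta> x y) * h x"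
      by simp
    also have "\<dots> = (\<Sum>y\<in>S. P \<delta> x y * (h y - h x))"
      by (simp add: sum_distrib_right sum_subtractf right_diff_distrib)
    finally show ?thesis
      by (simp add: sum_divide_distrib)
  qed
  have "((\<lambda>\<delta>. P \<delta> x y / \<delta> * (h y - h x)) \<longlongrightarrow> q x y * (h y - h x)) (at_right 0)" if "y \<in> S" for y
  proof (cases "y = x")
    case False
    then have "((\<lambda>\<delta>. P \<delta> x y / \<delta>) \<longlongrightarrow> q x y) (at_right 0)"
      using assms that by (simp add: transition_semigroup_def)
    then show ?thesis
      by (intro tendsto_mult tendsto_const)
  qed simp
  then have "((\<lambda>\<delta>. \<Sum>y\<in>S. P \<delta> x y / \<delta> * (h y - h x)) \<longlongrightarrow> (\<Sum>y\<in>S. q x y * (h y - h x))) (at_right 0)"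
    by (intro tendsto_sum)
  moreover have "\<forall>\<^sub>F \<delta> in at_right 0. ((\<Sum>y\<in>S. P \<delta> x y * h y) - h x) / \<delta> = (\<Sum>y\<in>S. P \<delta> x y / \<delta> * (h y - h x))"
    using eventually_at_right_less[of "0::real"] by eventually_elim (rule eq)
  ultimately show ?thesis
    by (simp add: filterlim_cong)
qed

context markov_jump_process
begin

lemma sets_state: "0 \<le> t \<Longrightarrow> {\<omega> \<in> space M. Q (X t \<omega>)} \<in> events"
proof -
  assume t: "0 \<le> t"
  have "{\<omega> \<in> space M. Q (X t \<omega>)} = X t -` {x \<in> S. Q x} \<inter> space M"
    using measurable_space[OF random_state[OF t]] by auto
  then show ?thesis
    using measurable_sets[OF random_state[OF t], of "{x \<in> S. Q x}"] by simp
qed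

lemma state_in: "0 \<le> t \<Longrightarrow> \<omega> \<in> space M \<Longrightarrow> X t \<omega> \<in> S"
  using measurable_space[OF random_state] by auto

lemma prob_sum_states:
  assumes "0 \<le> t" "T \<subseteq> S" "A \<in> events" "\<And>\<omega>. \<omega> \<in> A \<Longrightarrow> X t \<omega> \<in> T"
  shows "prob A = (\<Sum>x\<in>T. prob {\<omega> \<in> A. X t \<omega> = x})"
proof -
  have "{\<omega> \<in> A. X t \<omega> = x} \<in> events" for x
  proof -
    have "{\<omega> \<in> A. X t \<omega> = x} = A \<inter> {\<omega> \<in> space M. X t \<omega> = x}"
      using sets.sets_into_space[OF assms(3)] by auto
    then show ?thesis
      using assms(3) sets_state[OF assms(1), of "\<lambda>y. y = x"] by simp
  qed
  then have "prob (\<Union>x\<in>T. {\<omega> \<in> A. X t \<omega> = x}) = (\<Sum>x\<in>T. prob {\<omega> \<in> A. X t \<omega> = x})"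
    using finite_subset[OF \<open>T \<subseteq> S\<close> finite_state_space]
    by (intro finite_measure_finite_Union) (auto simp: disjoint_family_on_def)
  moreover have "(\<Union>x\<in>T. {\<omega> \<in> A. X t \<omega> = x}) = A"
    using assms(4) by auto
  ultimately show ?thesis
    by simp
qed

section \<open>The process on a grid, killed in the target set\<close>

text \<open>Grid time 0 is included, whereas \<open>hitting_time\<close> looks at positive times
  only; a start outside \<open>D\<close> reconciles the two.\<close>

definition avoid :: "'s set \<Rightarrow> real \<Rightarrow> nat \<Rightarrow> 'w set" where
  "avoid D \<delta> n = {\<omega> \<in> space M. \<forall>k\<le>n. X (real k * \<delta>) \<omega> \<notin> D}"

definition avoid_at :: "'s set \<Rightarrow> real \<Rightarrow> nat \<Rightarrow> 's \<Rightarrow> 'w set" where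
  "avoid_at D \<delta> n x = {\<omega> \<in> avoid D \<delta> n. X (real n * \<delta>) \<omega> = x}"

text \<open>The mean of \<open>h\<close> after \<open>n\<close> steps of the grid chain killed in
  \<open>D\<close>. If \<open>h\<close> vanishes on \<open>D\<close>, this is also its mean under
  the chain stopped on entering \<open>D\<close>.\<close>

definition avoid_mean :: "'s set \<Rightarrow> real \<Rightarrow> ('s \<Rightarrow> real) \<Rightarrow> nat \<Rightarrow> real" where
  "avoid_mean D \<delta> h n = (\<Sum>x\<in>S - D. prob (avoid_at D \<delta> n x) * h x)"

text \<open>The index is shifted so that time 0 is excluded, as in \<open>hitting_time\<close>. The
  value \<open>\<top>\<close> at grid points outside \<open>D\<close> lets the infimum range over
  all indices.\<close>

definition grid_hitting_time :: "'s set \<Rightarrow> real \<Rightarrow> 'w \<Rightarrow> ennreal" where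
  "grid_hitting_time D \<delta> \<omega> =
    (INF k. if X (real (Suc k) * \<delta>) \<omega> \<in> D then ennreal (real (Suc k) * \<delta>) else \<top>)"

context
  fixes D :: "'s set" and \<delta> :: real and P :: "real \<Rightarrow> 's \<Rightarrow> 's \<Rightarrow> real"
  assumes D: "D \<subseteq> S" and \<delta>: "0 < \<delta>"
    and fdd: "\<forall>n (t :: nat \<Rightarrow> real) x.
      0 \<le> t 0 \<and> (\<forall>k\<le>n. t k < t (Suc k)) \<and> (\<forall>k\<le>Suc n. x k \<in> S) \<longrightarrow>
      prob {\<omega> \<in> space M. \<forall>k\<le>Suc n. X (t k) \<omega> = x k} =
      prob {\<omega> \<in> space M. \<forall>k\<le>n. X (t k) \<omega> = x k} * P (t (Suc n) - t n) (x n) (x (Suc n))"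
begin

lemma grid_nonneg: "0 \<le> real k * \<delta>"
  using \<delta> by simp

lemma sets_avoid: "avoid D \<delta> n \<in> events"
  unfolding avoid_def using sets_state[OF grid_nonneg]
  by (auto intro: sets.sets_Collect_finite_All')

lemma sets_avoid_at: "avoid_at D \<delta> n x \<in> events"
proof -
  have "avoid_at D \<delta> n x = avoid D \<delta> n \<inter> {\<omega> \<in> space M. X (real n * \<delta>) \<omega> = x}"
    by (auto simp: avoid_at_def avoid_def)
  then show ?thesis
    using sets_avoid sets_state[OF grid_nonneg, of "\<lambda>y. y = x"] by simp
qed

lemma prob_avoid: "prob (avoid D \<delta> n) = (\<Sum>x\<in>S - D. prob (avoid_at D \<delta> n x))"
  unfolding avoid_at_def
  by (rule prob_sum_states[OF grid_nonneg _ sets_avoid])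
     (use state_in[OF grid_nonneg] in \<open>auto simp: avoid_def\<close>)

text \<open>The Markov property speaks only of events that fix the state at every listed time. The
  event of avoiding \<open>D\<close> is therefore split into finitely many cylinders, one for each
  history.\<close>

lemma prob_avoid_at_Suc:
  assumes "y \<in> S - D"
  shows "prob (avoid_at D \<delta> (Suc n) y) = (\<Sum>x\<in>S - D. prob (avoid_at D \<delta> n x) * P \<delta> x y)"
proof -
  define cyl where "cyl n z = {\<omega> \<in> space M. \<forall>k\<le>n. X (real k * \<delta>) \<omega> = z k}" for n and z :: "nat \<Rightarrow> 's"
  have sets_cyl: "cyl n z \<in> events" for n z
    unfolding cyl_def using sets_state[OF grid_nonneg]
    by (auto intro: sets.sets_Collect_finite_All')
  have avoid_at_cyl: "prob {\<omega> \<in> avoid_at D \<delta> n x. X (real (Suc n) * \<delta>) \<omega> = y} = prob (avoid_at D \<delta> n x) * P \<delta> x y"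
    if "x \<in> S - D" for x
  proof -
    \<comment> \<open>The histories outside \<open>D\<close> that end in \<open>x\<close>.
      Extensionality makes the set finite and makes distinct histories differ at some grid time, so
      that their cylinders are disjoint.\<close>
    define Z where "Z = {z \<in> {..n} \<rightarrow>\<^sub>E (S - D). z n = x}"
    have "finite Z"
      unfolding Z_def using finite_state_space
      by (intro finite_subset[OF _ finite_PiE[of "{..n}" "\<lambda>_. S - D"]]) auto
    have disj: "cyl n z \<inter> cyl n z' = {}" if "z \<in> Z" "z' \<in> Z" "z \<noteq> z'" for z z'
    proof -
      have "z \<in> {..n} \<rightarrow>\<^sub>E (S - D)" "z' \<in> {..n} \<rightarrow>\<^sub>E (S - D)"
        using that by (simp_all add: Z_def)
      then obtain k where "k \<in> {..n}" "z k \<noteq> z' k"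
        using PiE_ext \<open>z \<noteq> z'\<close> by metis
      then show ?thesis
        by (auto simp: cyl_def)
    qed
    have at_eq: "avoid_at D \<delta> n x = (\<Union>z\<in>Z. cyl n z)"
    proof (intro equalityI subsetI)
      fix \<omega> assume \<omega>: "\<omega> \<in> avoid_at D \<delta> n x"
      define z where "z = (\<lambda>k\<in>{..n}. X (real k * \<delta>) \<omega>)"
      have "z \<in> Z"
        using \<omega> state_in[OF grid_nonneg] by (auto simp: z_def Z_def avoid_at_def avoid_def)
      moreover have "\<omega> \<in> cyl n z"
        using \<omega> by (auto simp: z_def cyl_def avoid_at_def avoid_def)
      ultimately show "\<omega> \<in> (\<Union>z\<in>Z. cyl n z)"
        by blast
    next
      fix \<omega> assume "\<omega> \<in> (\<Union>z\<in>Z. cyl n z)"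
      then show "\<omega> \<in> avoid_at D \<delta> n x"
        by (auto simp: Z_def cyl_def avoid_at_def avoid_def PiE_iff)
    qed
    have cyl_Suc: "{\<omega> \<in> cyl n z. X (real (Suc n) * \<delta>) \<omega> = y} = cyl (Suc n) (z(Suc n := y))" for z
      unfolding cyl_def by (auto simp: le_Suc_eq simp del: of_nat_Suc)
    have step: "prob (cyl (Suc n) (z(Suc n := y))) = prob (cyl n z) * P \<delta> x y" if "z \<in> Z" for z
    proof -
      have "prob (cyl (Suc n) (z(Suc n := y))) =
          prob (cyl n (z(Suc n := y))) * P (real (Suc n) * \<delta> - real n * \<delta>) ((z(Suc n := y)) n) ((z(Suc n := y)) (Suc n))"
        unfolding cyl_def
        by (rule fdd[rule_format, of "\<lambda>k. real k * \<delta>"]) (use \<open>z \<in> Z\<close> \<open>y \<in> S - D\<close> \<delta> in \<open>auto simp: Z_def PiE_iff le_Suc_eq\<close>)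
      also have "cyl n (z(Suc n := y)) = cyl n z"
        by (auto simp: cyl_def)
      also have "real (Suc n) * \<delta> - real n * \<delta> = \<delta>"
        by (simp add: algebra_simps)
      finally show ?thesis
        using \<open>z \<in> Z\<close> by (simp only: Z_def mem_Collect_eq fun_upd_same fun_upd_other n_not_Suc_n not_False_eq_True)
    qed
    have "{\<omega> \<in> avoid_at D \<delta> n x. X (real (Suc n) * \<delta>) \<omega> = y} = (\<Union>z\<in>Z. cyl (Suc n) (z(Suc n := y)))"
      unfolding at_eq cyl_Suc[symmetric] by blast
    also have "prob \<dots> = (\<Sum>z\<in>Z. prob (cyl (Suc n) (z(Suc n := y))))"
    proof (rule finite_measure_finite_Union[OF \<open>finite Z\<close>])
      show "disjoint_family_on (\<lambda>z. cyl (Suc n) (z(Suc n := y))) Z"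
        unfolding disjoint_family_on_def cyl_Suc[symmetric] using disj by blast
    qed (use sets_cyl in auto)
    also have "\<dots> = (\<Sum>z\<in>Z. prob (cyl n z)) * P \<delta> x y"
      by (simp add: step sum_distrib_right)
    also have "(\<Sum>z\<in>Z. prob (cyl n z)) = prob (avoid_at D \<delta> n x)"
      unfolding at_eq using disj sets_cyl \<open>finite Z\<close>
      by (intro finite_measure_finite_Union[symmetric]) (auto simp: disjoint_family_on_def)
    finally show ?thesis .
  qed
  have "prob (avoid_at D \<delta> (Suc n) y) = (\<Sum>x\<in>S - D. prob {\<omega> \<in> avoid_at D \<delta> (Suc n) y. X (real n * \<delta>) \<omega> = x})"
  proof (rule prob_sum_states[OF grid_nonneg _ sets_avoid_at])
    show "X (real n * \<delta>) \<omega> \<in> S - D" if "\<omega> \<in> avoid_at D \<delta> (Suc n) y" for \<omega>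
      using that state_in[OF grid_nonneg] by (auto simp: avoid_at_def avoid_def)
  qed auto
  also have "\<dots> = (\<Sum>x\<in>S - D. prob (avoid_at D \<delta> n x) * P \<delta> x y)"
  proof (intro sum.cong refl)
    fix x assume "x \<in> S - D"
    have "{\<omega> \<in> avoid_at D \<delta> (Suc n) y. X (real n * \<delta>) \<omega> = x} =
        {\<omega> \<in> avoid_at D \<delta> n x. X (real (Suc n) * \<delta>) \<omega> = y}"
      using \<open>y \<in> S - D\<close> unfolding avoid_at_def avoid_def by (auto simp: le_Suc_eq simp del: of_nat_Suc)
    then show "prob {\<omega> \<in> avoid_at D \<delta> (Suc n) y. X (real n * \<delta>) \<omega> = x} = prob (avoid_at D \<delta> n x) * P \<delta> x y"
      using avoid_at_cyl[OF \<open>x \<in> S - D\<close>] by simp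
  qed
  finally show ?thesis .
qed

text \<open>Since \<open>h\<close> vanishes on \<open>D\<close>, the killed kernel may be replaced
  by the full kernel, to which the generator estimate applies.\<close>

lemma avoid_mean_Suc:
  assumes hD: "\<And>x. x \<in> D \<Longrightarrow> h x = 0"
  shows "avoid_mean D \<delta> h (Suc n) = avoid_mean D \<delta> (\<lambda>x. \<Sum>y\<in>S. P \<delta> x y * h y) n"
proof -
  have "avoid_mean D \<delta> h (Suc n) = (\<Sum>y\<in>S - D. (\<Sum>x\<in>S - D. prob (avoid_at D \<delta> n x) * P \<delta> x y) * h y)"
    unfolding avoid_mean_def using prob_avoid_at_Suc by (intro sum.cong) simp_all
  also have "\<dots> = (\<Sum>x\<in>S - D. \<Sum>y\<in>S - D. prob (avoid_at D \<delta> n x) * P \<delta> x y * h y)"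
    unfolding sum_distrib_right by (rule sum.swap)
  also have "\<dots> = (\<Sum>x\<in>S - D. prob (avoid_at D \<delta> n x) * (\<Sum>y\<in>S. P \<delta> x y * h y))"
  proof (intro sum.cong refl)
    fix x
    have "(\<Sum>y\<in>S - D. P \<delta> x y * h y) = (\<Sum>y\<in>S. P \<delta> x y * h y)"
      using finite_state_space hD by (intro sum.mono_neutral_left) auto
    then show "(\<Sum>y\<in>S - D. prob (avoid_at D \<delta> n x) * P \<delta> x y * h y) =
        prob (avoid_at D \<delta> n x) * (\<Sum>y\<in>S. P \<delta> x y * h y)"
      by (simp add: sum_distrib_left[symmetric] mult.assoc)
  qed
  finally show ?thesis
    by (simp add: avoid_mean_def)
qed

lemma avoid_mean_0:
  assumes "AE \<omega> in M. X 0 \<omega> = s" "s \<in> S - D"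
  shows "avoid_mean D \<delta> h 0 = h s"
proof -
  have X0: "X (real 0 * \<delta>) = X 0"
    by simp
  have ae: "prob (avoid_at D \<delta> 0 x) = (if x = s then 1 else 0)" if "x \<in> S - D" for x
  proof (cases "x = s")
    case True
    have "prob (avoid_at D \<delta> 0 x) = 1"
      using assms(1) that True sets_avoid_at[of 0 x]
      by (subst prob_eq_1) (auto simp: avoid_at_def avoid_def)
    then show ?thesis
      using True by simp
  next
    case False
    have "prob (avoid_at D \<delta> 0 x) = 0"
      using assms(1) False sets_avoid_at[of 0 x]
      by (subst prob_eq_0) (auto simp: avoid_at_def avoid_def)
    then show ?thesis
      using False by simp
  qed
  have "avoid_mean D \<delta> h 0 = (\<Sum>x\<in>S - D. if x = s then h s else 0)"
    unfolding avoid_mean_def by (intro sum.cong) (simp_all add: ae)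
  then show ?thesis
    using assms(2) finite_state_space by simp
qed

lemma avoid_mean_mono: "(\<And>x. x \<in> S - D \<Longrightarrow> f x \<le> g x) \<Longrightarrow> avoid_mean D \<delta> f n \<le> avoid_mean D \<delta> g n"
  unfolding avoid_mean_def by (intro sum_mono mult_left_mono) auto

lemma avoid_mean_diff_const: "avoid_mean D \<delta> (\<lambda>x. f x - c) n = avoid_mean D \<delta> f n - c * prob (avoid D \<delta> n)"
proof -
  have "avoid_mean D \<delta> (\<lambda>x. f x - c) n = (\<Sum>x\<in>S - D. prob (avoid_at D \<delta> n x) * f x - c * prob (avoid_at D \<delta> n x))"
    unfolding avoid_mean_def by (intro sum.cong) (simp_all add: algebra_simps)
  then show ?thesis
    by (simp only: avoid_mean_def prob_avoid sum_subtractf sum_distrib_left)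
qed

text \<open>A discrete Dynkin formula: in step \<open>n\<close> the killed mean of \<open>h\<close>
  loses between \<open>a\<close> and \<open>b\<close> times the probability of still avoiding
  \<open>D\<close>, and the losses telescope from \<open>h s\<close>. Nonnegativity of the remainder
  gives summability, which in turn makes the remainder vanish.\<close>

lemma sum_prob_avoid:
  assumes start: "AE \<omega> in M. X 0 \<omega> = s" "s \<in> S - D"
    and hD: "\<And>x. x \<in> D \<Longrightarrow> h x = 0" and h_nonneg: "\<And>x. x \<in> S \<Longrightarrow> 0 \<le> h x"
    and lower: "\<And>x. x \<in> S - D \<Longrightarrow> h x - b \<le> (\<Sum>y\<in>S. P \<delta> x y * h y)"
    and upper: "\<And>x. x \<in> S - D \<Longrightarrow> (\<Sum>y\<in>S. P \<delta> x y * h y) \<le> h x - a"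
    and "0 < a"
  shows "summable (\<lambda>n. prob (avoid D \<delta> n))" "a * (\<Sum>n. prob (avoid D \<delta> n)) \<le> h s"
    "h s \<le> b * (\<Sum>n. prob (avoid D \<delta> n))"
proof -
  let ?p = "\<lambda>n. prob (avoid D \<delta> n)"
  have mean_Suc: "avoid_mean D \<delta> h (Suc n) = avoid_mean D \<delta> (\<lambda>x. \<Sum>y\<in>S. P \<delta> x y * h y) n" for n
    using hD by (rule avoid_mean_Suc)
  have up: "avoid_mean D \<delta> h (Suc n) \<le> avoid_mean D \<delta> h n - a * ?p n" for n
    unfolding mean_Suc avoid_mean_diff_const[symmetric]
    by (rule avoid_mean_mono) (rule upper)
  have lo: "avoid_mean D \<delta> h n - b * ?p n \<le> avoid_mean D \<delta> h (Suc n)" for n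
    unfolding mean_Suc avoid_mean_diff_const[symmetric]
    by (rule avoid_mean_mono) (rule lower)
  have mean_nonneg: "0 \<le> avoid_mean D \<delta> h n" for n
    unfolding avoid_mean_def using h_nonneg by (intro sum_nonneg) auto
  have sum_up: "a * (\<Sum>k<n. ?p k) \<le> h s - avoid_mean D \<delta> h n" for n
  proof (induction n)
    case (Suc n)
    have "a * (\<Sum>k<Suc n. ?p k) = a * (\<Sum>k<n. ?p k) + a * ?p n"
      by (simp add: distrib_left)
    then show ?case
      using up[of n] Suc.IH by linarith
  qed (simp add: avoid_mean_0[OF start])
  have sum_lo: "h s - avoid_mean D \<delta> h n \<le> b * (\<Sum>k<n. ?p k)" for n
  proof (induction n)
    case (Suc n)
    have "b * (\<Sum>k<Suc n. ?p k) = b * (\<Sum>k<n. ?p k) + b * ?p n"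
      by (simp add: distrib_left)
    then show ?case
      using lo[of n] Suc.IH by linarith
  qed (simp add: avoid_mean_0[OF start])
  have bound: "(\<Sum>k<n. ?p k) \<le> h s / a" for n
    using sum_up[of n] mean_nonneg[of n] \<open>0 < a\<close> by (simp add: field_simps)
  show summ: "summable ?p"
    using bound by (intro summableI_nonneg_bounded) auto
  have "suminf ?p \<le> h s / a"
    using bound by (intro suminf_le_const[OF summ]) auto
  then show "a * suminf ?p \<le> h s"
    using \<open>0 < a\<close> by (simp add: field_simps)
  \<comment> \<open>The sum bounds each value of the nonnegative function \<open>h\<close>, so the
    remainder is at most \<open>H\<close> times the avoidance probability, which tends to 0.\<close>
  define H where "H = (\<Sum>x\<in>S. h x)"
  have "avoid_mean D \<delta> h n \<le> H * ?p n" for n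
  proof -
    have "avoid_mean D \<delta> h n \<le> (\<Sum>x\<in>S - D. prob (avoid_at D \<delta> n x) * H)"
      unfolding avoid_mean_def H_def using h_nonneg finite_state_space
      by (intro sum_mono mult_left_mono member_le_sum) auto
    then show ?thesis
      by (simp add: prob_avoid sum_distrib_right mult.commute[of H])
  qed
  then have "h s - H * ?p n \<le> b * (\<Sum>k<n. ?p k)" for n
    using sum_lo[of n] by (meson diff_left_mono order_trans)
  moreover have "(\<lambda>n. h s - H * ?p n) \<longlonglongrightarrow> h s - H * 0"
    by (intro tendsto_diff tendsto_mult tendsto_const summable_LIMSEQ_zero[OF summ])
  moreover have "(\<lambda>n. b * (\<Sum>k<n. ?p k)) \<longlonglongrightarrow> b * suminf ?p"
    by (intro tendsto_mult tendsto_const summable_LIMSEQ[OF summ])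
  ultimately show "h s \<le> b * suminf ?p"
    using LIMSEQ_le by (metis (no_types, lifting) diff_zero mult_zero_right)
qed

lemma measurable_grid_hitting_time: "grid_hitting_time D \<delta> \<in> borel_measurable M"
proof -
  have "(\<lambda>\<omega>. if X (real (Suc k) * \<delta>) \<omega> \<in> D then ennreal (real (Suc k) * \<delta>) else \<top>) \<in> borel_measurable M" for k
    using sets_state[OF grid_nonneg, of "\<lambda>x. x \<in> D" "Suc k"] by (intro measurable_If) auto
  then show ?thesis
    unfolding grid_hitting_time_def by (intro borel_measurable_INF) auto
qed

text \<open>The first hitting index is the number of \<open>n\<close> for which \<open>D\<close> has
  been avoided up to \<open>n\<close>. In this form the mean becomes a series of avoidance
  probabilities.\<close>

lemma grid_hitting_time_eq:
  assumes "\<omega> \<in> space M" "X 0 \<omega> \<notin> D"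
  shows "grid_hitting_time D \<delta> \<omega> = (\<Sum>n. ennreal \<delta> * indicator (avoid D \<delta> n) \<omega>)"
proof (cases "\<exists>k. X (real k * \<delta>) \<omega> \<in> D")
  case True
  define K where "K = (LEAST k. X (real k * \<delta>) \<omega> \<in> D)"
  have K: "X (real K * \<delta>) \<omega> \<in> D"
    unfolding K_def using LeastI_ex[OF True] .
  have K_le: "K \<le> k" if "X (real k * \<delta>) \<omega> \<in> D" for k
    unfolding K_def using Least_le[of "\<lambda>k. X (real k * \<delta>) \<omega> \<in> D", OF that] .
  \<comment> \<open>The start outside \<open>D\<close> excludes index 0 and so matches the shift in
    \<open>grid_hitting_time\<close>.\<close>
  obtain K' where K': "K = Suc K'"
    using K assms(2) by (cases K) auto
  have mem_avoid: "\<omega> \<in> avoid D \<delta> n \<longleftrightarrow> n < K" for n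
    unfolding avoid_def using K K_le assms(1) by (auto simp: not_le[symmetric] dest: order_trans)
  have "(\<Sum>n. ennreal \<delta> * indicator (avoid D \<delta> n) \<omega>) = (\<Sum>n<K. ennreal \<delta> * indicator (avoid D \<delta> n) \<omega>)"
    by (intro suminf_finite) (auto simp: mem_avoid)
  also have "\<dots> = (\<Sum>n<K. ennreal \<delta>)"
    by (intro sum.cong) (auto simp: mem_avoid)
  also have "\<dots> = ennreal (real K * \<delta>)"
    using \<delta> by (simp add: ennreal_mult ennreal_of_nat_eq_real_of_nat)
  also have "\<dots> = grid_hitting_time D \<delta> \<omega>"
    unfolding grid_hitting_time_def
  proof (intro antisym INF_greatest)
    fix k
    show "ennreal (real K * \<delta>) \<le> (if X (real (Suc k) * \<delta>) \<omega> \<in> D then ennreal (real (Suc k) * \<delta>) else \<top>)"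
      using K_le[of "Suc k"] \<delta> by (auto intro!: ennreal_leI mult_right_mono simp del: of_nat_Suc)
  next
    show "(INF k. if X (real (Suc k) * \<delta>) \<omega> \<in> D then ennreal (real (Suc k) * \<delta>) else \<top>) \<le> ennreal (real K * \<delta>)"
      using K by (intro INF_lower2[of K']) (auto simp: K' simp del: of_nat_Suc)
  qed
  finally show ?thesis ..
next
  case False
  \<comment> \<open>If the grid never meets \<open>D\<close>, all terms equal the positive constant
    \<open>\<delta>\<close> and the series diverges.\<close>
  have "\<top> \<le> (\<Sum>n. ennreal \<delta> * indicator (avoid D \<delta> n) \<omega>)"
  proof (rule ccontr)
    assume "\<not> \<top> \<le> (\<Sum>n. ennreal \<delta> * indicator (avoid D \<delta> n) \<omega>)"
    then have fin: "(\<Sum>n. ennreal \<delta> * indicator (avoid D \<delta> n) \<omega>) < \<top>"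
      by (simp add: not_le)
    have const: "(\<lambda>n. ennreal \<delta> * indicator (avoid D \<delta> n) \<omega>) = (\<lambda>n. ennreal \<delta>)"
      using False assms(1) by (auto simp: avoid_def indicator_def)
    have "summable (\<lambda>n::nat. \<delta>)"
      using fin \<delta> unfolding const by (intro summable_suminf_not_top) auto
    then show False
      using \<delta> by (simp add: summable_const_iff)
  qed
  then show ?thesis
    using False by (auto simp: grid_hitting_time_def top_unique simp del: of_nat_Suc)
qed

lemma nn_integral_grid_hitting_time:
  assumes "AE \<omega> in M. X 0 \<omega> = s" "s \<in> S - D" and summ: "summable (\<lambda>n. prob (avoid D \<delta> n))"
  shows "(\<integral>\<^sup>+\<omega>. grid_hitting_time D \<delta> \<omega> \<partial>M) = ennreal (\<delta> * (\<Sum>n. prob (avoid D \<delta> n)))"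
proof -
  have "(\<integral>\<^sup>+\<omega>. grid_hitting_time D \<delta> \<omega> \<partial>M) = (\<integral>\<^sup>+\<omega>. (\<Sum>n. ennreal \<delta> * indicator (avoid D \<delta> n) \<omega>) \<partial>M)"
  proof (rule nn_integral_cong_AE, rule AE_mp[OF assms(1)], intro AE_I2 impI)
    fix \<omega> assume "\<omega> \<in> space M" "X 0 \<omega> = s"
    then show "grid_hitting_time D \<delta> \<omega> = (\<Sum>n. ennreal \<delta> * indicator (avoid D \<delta> n) \<omega>)"
      using grid_hitting_time_eq[of \<omega>] assms(2) by simp
  qed
  also have "\<dots> = (\<Sum>n. ennreal \<delta> * emeasure M (avoid D \<delta> n))"
  proof (subst nn_integral_suminf)
    show "(\<lambda>\<omega>. ennreal \<delta> * indicator (avoid D \<delta> n) \<omega>) \<in> borel_measurable M" for n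
      by (intro borel_measurable_times_ennreal borel_measurable_const borel_measurable_indicator sets_avoid)
    show "(\<Sum>n. \<integral>\<^sup>+\<omega>. ennreal \<delta> * indicator (avoid D \<delta> n) \<omega> \<partial>M) = (\<Sum>n. ennreal \<delta> * emeasure M (avoid D \<delta> n))"
      by (intro arg_cong[where f = suminf] ext nn_integral_cmult_indicator sets_avoid)
  qed
  also have "\<dots> = (\<Sum>n. ennreal (\<delta> * prob (avoid D \<delta> n)))"
    using \<delta> by (simp add: emeasure_eq_measure ennreal_mult)
  also have "\<dots> = ennreal (\<Sum>n. \<delta> * prob (avoid D \<delta> n))"
    using \<delta> summ by (intro suminf_ennreal2) (auto intro: summable_mult)
  finally show ?thesis
    using summ by (simp add: suminf_mult)
qed

end

section \<open>From dyadic grids to continuous time\<close>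

lemma grid_hitting_time_refine:
  "grid_hitting_time D (1 / 2 ^ Suc n) \<omega> \<le> grid_hitting_time D (1 / 2 ^ n) \<omega>"
  unfolding grid_hitting_time_def
proof (rule INF_greatest)
  fix k
  \<comment> \<open>Point \<open>Suc k\<close> of the coarse grid is point
    \<open>2 * Suc k = Suc (2 * k + 1)\<close> of the fine one.\<close>
  have eq: "real (Suc (2 * k + 1)) * (1 / 2 ^ Suc n) = real (Suc k) * (1 / 2 ^ n)"
    by (simp add: field_simps)
  show "(INF k. if X (real (Suc k) * (1 / 2 ^ Suc n)) \<omega> \<in> D
         then ennreal (real (Suc k) * (1 / 2 ^ Suc n)) else \<top>) \<le>
      (if X (real (Suc k) * (1 / 2 ^ n)) \<omega> \<in> D then ennreal (real (Suc k) * (1 / 2 ^ n)) else \<top>)"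
    by (rule INF_lower2[of "2 * k + 1"]) (simp_all only: eq order_refl UNIV_I)
qed

text \<open>After a visit to \<open>D\<close> at time \<open>t\<close> the path keeps its value on a
  nondegenerate interval to the right of \<open>t\<close>. A sufficiently fine grid has a point in
  that interval, arbitrarily close to \<open>t\<close>.\<close>

lemma hitting_time_eq_INF_grid:
  assumes "\<omega> \<in> space M"
  shows "hitting_time X D \<omega> = (INF n. grid_hitting_time D (1 / 2 ^ n) \<omega>)"
proof (rule antisym)
  show "hitting_time X D \<omega> \<le> (INF n. grid_hitting_time D (1 / 2 ^ n) \<omega>)"
    unfolding grid_hitting_time_def hitting_time_def
    by (intro INF_greatest) (auto intro!: INF_lower simp del: of_nat_Suc)
next
  show "(INF n. grid_hitting_time D (1 / 2 ^ n) \<omega>) \<le> hitting_time X D \<omega>"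
    unfolding hitting_time_def
  proof (rule INF_greatest)
    fix t assume "t \<in> {t. 0 < t \<and> X t \<omega> \<in> D}"
    then have t: "0 < t" "X t \<omega> \<in> D"
      by auto
    obtain b where b: "t < b" "\<And>u. t < u \<Longrightarrow> u < b \<Longrightarrow> X u \<omega> = X t \<omega>"
      using right_continuous[OF assms, of t] t(1) by (auto simp: eventually_at_right[of t "t + 1"])
    show "(INF n. grid_hitting_time D (1 / 2 ^ n) \<omega>) \<le> ennreal t"
    proof (rule ennreal_le_epsilon)
      fix e :: real assume "0 < e"
      obtain n where n: "(1 / 2) ^ n < min e (b - t)"
        using real_arch_pow_inv[of "min e (b - t)" "1 / 2"] \<open>0 < e\<close> b(1) by auto
      \<comment> \<open>\<open>Suc k\<close> indexes the first grid point strictly after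
        \<open>t\<close>; strictness matters because \<open>b\<close> controls the path only to the
        right of \<open>t\<close>.\<close>
      define k where "k = nat \<lfloor>t * 2 ^ n\<rfloor>"
      have "real k = of_int \<lfloor>t * 2 ^ n\<rfloor>"
        using t(1) by (simp add: k_def)
      then have k: "real k \<le> t * 2 ^ n" "t * 2 ^ n < real k + 1"
        by linarith+
      define u where "u = real (Suc k) * (1 / 2 ^ n)"
      have u: "t < u" "u \<le> t + (1 / 2) ^ n"
        using k unfolding u_def by (simp_all add: field_simps)
      have "X u \<omega> \<in> D"
        using b(2)[of u] u n t(2) by auto
      then have "grid_hitting_time D (1 / 2 ^ n) \<omega> \<le> ennreal u"
        unfolding grid_hitting_time_def u_def by (intro INF_lower2[of k]) (auto simp del: of_nat_Suc)
      also have "\<dots> \<le> ennreal (t + e)"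
        using u n by (intro ennreal_leI) auto
      also have "\<dots> = ennreal t + ennreal e"
        using t(1) \<open>0 < e\<close> by simp
      finally show "(INF n. grid_hitting_time D (1 / 2 ^ n) \<omega>) \<le> ennreal t + ennreal e"
        by (rule INF_lower2[OF UNIV_I])
    qed
  qed
qed

text \<open>The equation \<open>gen h = - 1\<close> makes the one-step decrease of \<open>h\<close>
  asymptotic to the mesh, uniformly over the finite state space. This squeezes the mean grid hitting
  times towards \<open>h s\<close>.\<close>

theorem nn_integral_hitting_time:
  assumes D: "D \<subseteq> S" and start: "AE \<omega> in M. X 0 \<omega> = s" "s \<in> S - D"
    and hD: "\<And>x. x \<in> D \<Longrightarrow> h x = 0" and h_nonneg: "\<And>x. x \<in> S \<Longrightarrow> 0 \<le> h x"
    and gen: "\<And>x. x \<in> S - D \<Longrightarrow> (\<Sum>y\<in>S. q x y * (h y - h x)) = - 1"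
  shows "(\<integral>\<^sup>+\<omega>. hitting_time X D \<omega> \<partial>M) = ennreal (h s)"
proof -
  obtain P where P: "transition_semigroup S q P" and
    fdd: "\<forall>n (t :: nat \<Rightarrow> real) x.
      0 \<le> t 0 \<and> (\<forall>k\<le>n. t k < t (Suc k)) \<and> (\<forall>k\<le>Suc n. x k \<in> S) \<longrightarrow>
      prob {\<omega> \<in> space M. \<forall>k\<le>Suc n. X (t k) \<omega> = x k} =
      prob {\<omega> \<in> space M. \<forall>k\<le>n. X (t k) \<omega> = x k} * P (t (Suc n) - t n) (x n) (x (Suc n))"
    using markov_property by blast
  define \<delta> where "\<delta> n = (1 / 2 ^ n :: real)" for n
  have \<delta>_pos: "0 < \<delta> n" for n
    by (simp add: \<delta>_def)
  have \<delta>_lim: "filterlim \<delta> (at_right 0) sequentially"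
    unfolding \<delta>_def by real_asymp
  define u where "u n = \<delta> n * (\<Sum>k. prob (avoid D (\<delta> n) k))" for n
  have bounds: "\<forall>\<^sub>F n in sequentially. summable (\<lambda>k. prob (avoid D (\<delta> n) k)) \<and>
      (1 - \<epsilon>) * u n \<le> h s \<and> h s \<le> (1 + \<epsilon>) * u n" if "0 < \<epsilon>" "\<epsilon> < 1" for \<epsilon>
  proof -
    have "\<forall>\<^sub>F d in at_right 0. \<forall>x\<in>S - D. dist (((\<Sum>y\<in>S. P d x y * h y) - h x) / d) (- 1) < \<epsilon>"
    proof (intro eventually_ball_finite ballI tendstoD)
      fix x assume "x \<in> S - D"
      then show "((\<lambda>d. ((\<Sum>y\<in>S. P d x y * h y) - h x) / d) \<longlongrightarrow> - 1) (at_right 0)"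
        using transition_semigroup_generator[OF P, of x h] gen[of x] by simp
    qed (use finite_state_space \<open>0 < \<epsilon>\<close> in auto)
    then have "\<forall>\<^sub>F n in sequentially. \<forall>x\<in>S - D. dist (((\<Sum>y\<in>S. P (\<delta> n) x y * h y) - h x) / \<delta> n) (- 1) < \<epsilon>"
      using \<delta>_lim by (rule eventually_compose_filterlim)
    then show ?thesis
    proof eventually_elim
      case (elim n)
      have *: "h x - (1 + \<epsilon>) * \<delta> n \<le> (\<Sum>y\<in>S. P (\<delta> n) x y * h y)"
        "(\<Sum>y\<in>S. P (\<delta> n) x y * h y) \<le> h x - (1 - \<epsilon>) * \<delta> n" if "x \<in> S - D" for x
      proof -
        define r where "r = ((\<Sum>y\<in>S. P (\<delta> n) x y * h y) - h x) / \<delta> n"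
        have "(\<Sum>y\<in>S. P (\<delta> n) x y * h y) = h x + r * \<delta> n"
          using \<delta>_pos[of n] by (simp add: r_def)
        moreover have "dist r (- 1) < \<epsilon>"
          unfolding r_def using elim that by blast
        then have r: "- (1 + \<epsilon>) \<le> r" "r \<le> - (1 - \<epsilon>)"
          by (auto simp: dist_real_def abs_less_iff)
        moreover have "- (1 + \<epsilon>) * \<delta> n \<le> r * \<delta> n" "r * \<delta> n \<le> - (1 - \<epsilon>) * \<delta> n"
          using r \<delta>_pos[of n] by (intro mult_right_mono; simp)+
        ultimately show "h x - (1 + \<epsilon>) * \<delta> n \<le> (\<Sum>y\<in>S. P (\<delta> n) x y * h y)"
          "(\<Sum>y\<in>S. P (\<delta> n) x y * h y) \<le> h x - (1 - \<epsilon>) * \<delta> n"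
          by (simp_all add: algebra_simps)
      qed
      have "0 < (1 - \<epsilon>) * \<delta> n"
        using \<delta>_pos \<open>\<epsilon> < 1\<close> by simp
      note sum_prob_avoid[OF D \<delta>_pos fdd start hD h_nonneg * this]
      then show ?case
        by (simp add: u_def mult.assoc)
    qed
  qed
  have u_nonneg: "0 \<le> u n" if "summable (\<lambda>k. prob (avoid D (\<delta> n) k))" for n
    using that \<delta>_pos[of n] by (simp add: u_def suminf_nonneg)
  have hs: "0 \<le> h s"
    using h_nonneg start by auto
  have "u \<longlonglongrightarrow> h s"
  proof (rule tendstoI)
    fix e :: real assume "0 < e"
    \<comment> \<open>The bound \<open>1 / 2\<close> yields \<open>u n \<le> 2 * h s\<close>; the
      other bound then makes the error \<open>\<epsilon> * u n\<close> smaller than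
      \<open>e\<close>. Adding 1 keeps the denominator positive when \<open>h s = 0\<close>.\<close>
    define \<epsilon> where "\<epsilon> = min (1 / 2) (e / (4 * (h s + 1)))"
    have "\<epsilon> \<le> e / (4 * (h s + 1))" "0 < 4 * (h s + 1)"
      using hs by (simp_all add: \<epsilon>_def)
    then have "\<epsilon> * (4 * (h s + 1)) \<le> e"
      by (simp only: pos_le_divide_eq)
    moreover have "0 < \<epsilon>" "\<epsilon> \<le> 1 / 2"
      using \<open>0 < e\<close> hs unfolding \<epsilon>_def by (simp_all only: min_less_iff_conj min.cobounded1) simp
    ultimately have \<epsilon>: "0 < \<epsilon>" "\<epsilon> \<le> 1 / 2" "\<epsilon> * (4 * (h s + 1)) \<le> e"
      by blast+
    then have "\<epsilon> < 1"
      by simp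
    show "\<forall>\<^sub>F n in sequentially. dist (u n) (h s) < e"
      using bounds[OF \<epsilon>(1) \<open>\<epsilon> < 1\<close>]
    proof eventually_elim
      case (elim n)
      have u0: "0 \<le> u n"
        using elim u_nonneg by blast
      have "1 / 2 * u n \<le> (1 - \<epsilon>) * u n"
        using \<epsilon>(2) u0 by (intro mult_right_mono) auto
      then have "u n \<le> 2 * h s"
        using elim by linarith
      then have "\<epsilon> * u n \<le> \<epsilon> * (2 * h s)"
        using \<epsilon>(1) by (intro mult_left_mono) auto
      also have "\<dots> < \<epsilon> * (4 * (h s + 1))"
        using \<epsilon>(1) hs by (intro mult_strict_left_mono) auto
      finally have "\<epsilon> * u n < e"
        using \<epsilon>(3) by linarith
      then show ?case
        using elim by (auto simp: dist_real_def abs_less_iff algebra_simps)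
    qed
  qed
  then have u_lim: "(\<lambda>n. ennreal (u n)) \<longlonglongrightarrow> ennreal (h s)"
    by (rule tendsto_ennrealI)
  define I where "I n = (\<integral>\<^sup>+\<omega>. grid_hitting_time D (\<delta> n) \<omega> \<partial>M)" for n
  have I_eq: "\<forall>\<^sub>F n in sequentially. ennreal (u n) = I n"
    using bounds[of "1 / 2", simplified]
    by eventually_elim (simp add: I_def u_def nn_integral_grid_hitting_time[OF D \<delta>_pos fdd start])
  \<comment> \<open>Monotone convergence for decreasing sequences requires one finite integral; mesh
    \<open>\<delta> m\<close> provides it.\<close>
  then obtain m where m: "ennreal (u m) = I m"
    using eventually_happens[OF I_eq] trivial_limit_sequentially by blast
  have "I \<longlonglongrightarrow> ennreal (h s)"
    using I_eq u_lim by (rule Lim_transform_eventually[rotated])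
  moreover have "decseq I"
    unfolding I_def \<delta>_def
    by (intro decseq_SucI nn_integral_mono grid_hitting_time_refine)
  then have "I \<longlonglongrightarrow> (INF n. I n)"
    by (rule LIMSEQ_INF)
  ultimately have "(INF n. I n) = ennreal (h s)"
    using LIMSEQ_unique by blast
  moreover have "(\<integral>\<^sup>+\<omega>. (INF n. grid_hitting_time D (\<delta> n) \<omega>) \<partial>M) = (INF n. I n)"
    unfolding I_def
  proof (rule nn_integral_monotone_convergence_INF_decseq)
    show "decseq (\<lambda>n \<omega>. grid_hitting_time D (\<delta> n) \<omega>)"
      unfolding \<delta>_def by (intro decseq_SucI le_funI grid_hitting_time_refine)
    show "(\<lambda>\<omega>. grid_hitting_time D (\<delta> n) \<omega>) \<in> borel_measurable M" for n
      using measurable_grid_hitting_time[OF D \<delta>_pos fdd] by simp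
    show "(\<integral>\<^sup>+\<omega>. grid_hitting_time D (\<delta> m) \<omega> \<partial>M) < \<infinity>"
      using m unfolding I_def by (metis ennreal_less_top infinity_ennreal_def)
  qed
  moreover have "(\<integral>\<^sup>+\<omega>. hitting_time X D \<omega> \<partial>M) = (\<integral>\<^sup>+\<omega>. (INF n. grid_hitting_time D (\<delta> n) \<omega>) \<partial>M)"
    unfolding \<delta>_def by (intro nn_integral_cong hitting_time_eq_INF_grid)
  ultimately show ?thesis
    by simp
qed

end

section \<open>Conflict graphs\<close>

text \<open>A constant factor adds \<open>ln c / ln x\<close> to the logarithm, which tends to 0. It
  is essential that \<open>a\<close> and \<open>b\<close> do not depend on \<open>x\<close>.\<close>

lemma log_tendsto_exponent:
  fixes f :: "real \<Rightarrow> real"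
  assumes "0 < a" "0 < b"
    and f: "\<And>x. 1 < x \<Longrightarrow> a * x powr e \<le> f x" "\<And>x. 1 < x \<Longrightarrow> f x \<le> b * x powr e"
  shows "((\<lambda>x. log x (f x)) \<longlongrightarrow> e) at_top"
proof (rule tendsto_sandwich)
  have log_eq: "log x (c * x powr e) = log x c + e" if "0 < c" "1 < x" for c x :: real
    using that by (simp add: log_mult)
  show "\<forall>\<^sub>F x in at_top. log x a + e \<le> log x (f x)"
    using eventually_gt_at_top[of 1]
  proof eventually_elim
    case (elim x)
    have "0 < a * x powr e"
      using elim \<open>0 < a\<close> by simp
    then show ?case
      using elim f(1)[OF elim] log_eq[OF \<open>0 < a\<close> elim] log_le_cancel_iff[of x "a * x powr e" "f x"] by simp
  qed
  show "\<forall>\<^sub>F x in at_top. log x (f x) \<le> log x b + e"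
    using eventually_gt_at_top[of 1]
  proof eventually_elim
    case (elim x)
    have "0 < a * x powr e"
      using elim \<open>0 < a\<close> by simp
    then have "0 < f x" "0 < b * x powr e"
      using f[OF elim] by linarith+
    then show ?case
      using elim f(2)[OF elim] log_eq[OF \<open>0 < b\<close> elim] log_le_cancel_iff[of x "f x" "b * x powr e"] by simp
  qed
  have "((\<lambda>x. ln c / ln x) \<longlongrightarrow> 0) at_top" for c :: real
    by (intro tendsto_divide_0[OF tendsto_const] filterlim_at_top_imp_at_infinity ln_at_top)
  then have "((\<lambda>x. log x c + e) \<longlongrightarrow> 0 + e) at_top" for c :: real
    unfolding log_def by (intro tendsto_add tendsto_const)
  then show "((\<lambda>x. log x a + e) \<longlongrightarrow> e) at_top" "((\<lambda>x. log x b + e) \<longlongrightarrow> e) at_top"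
    by simp_all
qed

context
  fixes N C :: nat and E :: "nat \<Rightarrow> (nat \<times> nat) set"
begin

section \<open>Activation steps, conductances and connectedness\<close>

text \<open>The node is idle, so the increment in \<open>rate\<close> is an assignment. In this form
  a deactivation is exactly the converse relation, which exposes reversibility.\<close>

definition activation :: "(nat \<Rightarrow> nat) \<Rightarrow> (nat \<Rightarrow> nat) \<Rightarrow> bool" where
  "activation x y \<longleftrightarrow> (\<exists>i\<in>{1..N}. \<exists>c\<in>{1..C}. x i = 0 \<and> y = x(i := c))"

definition adjacent :: "(nat \<Rightarrow> nat) \<Rightarrow> (nat \<Rightarrow> nat) \<Rightarrow> bool" where
  "adjacent x y \<longleftrightarrow> activation x y \<or> activation y x"

lemma active_activation:
  assumes "activation x y"
  shows "active N y = Suc (active N x)"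
proof -
  obtain i c where i: "i \<in> {1..N}" "1 \<le> c" "x i = 0" "y = x(i := c)"
    using assms by (auto simp: activation_def)
  have "(\<Sum>j\<in>{1..N} - {i}. if y j \<noteq> 0 then 1 else 0) = (\<Sum>j\<in>{1..N} - {i}. if x j \<noteq> 0 then 1 else (0::nat))"
    using i by (intro sum.cong) auto
  then show ?thesis
    using i unfolding active_def by (subst (1 2) sum.remove[of _ i]) auto
qed

lemma active_adjacent:
  "adjacent x y \<Longrightarrow> active N y = Suc (active N x) \<or> active N x = Suc (active N y)"
  using active_activation by (auto simp: adjacent_def)

lemma rate_eq: "rate N C \<nu> x y = (if activation x y then \<nu> else if activation y x then 1 else 0)"
proof -
  have "(\<exists>i\<in>{1..N}. \<exists>c\<in>{1..C}. x i = 0 \<and> y = x(i := x i + c)) \<longleftrightarrow> activation x y"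
    unfolding activation_def by (intro bex_cong refl conj_cong) simp
  moreover have "x i = c \<and> y = x(i := x i - c) \<longleftrightarrow> y i = 0 \<and> x = y(i := c)" for i c
    by auto
  then have "(\<exists>i\<in>{1..N}. \<exists>c\<in>{1..C}. x i = c \<and> y = x(i := x i - c)) \<longleftrightarrow> activation y x"
    unfolding activation_def by simp
  ultimately show ?thesis
    by (simp add: rate_def)
qed

lemma rate_pos_iff_adjacent: "1 < \<nu> \<Longrightarrow> 0 < rate N C \<nu> x y \<longleftrightarrow> adjacent x y"
  by (simp add: rate_eq adjacent_def)

text \<open>Going up, the rate supplies the missing factor \<nu>; going down, the rate is 1 and the
  weight is already that of the busier state. The result is symmetric in \<open>x\<close> and
  \<open>y\<close>, which is detailed balance.\<close>

lemma conductance_eq: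
  assumes "1 < \<nu>"
  shows "\<nu> ^ active N x * rate N C \<nu> x y =
    (if adjacent x y then \<nu> ^ max (active N x) (active N y) else 0)"
proof (cases "activation x y")
  case True
  then show ?thesis
    using active_activation[OF True] by (simp add: rate_eq adjacent_def)
next
  case False
  show ?thesis
  proof (cases "activation y x")
    case True
    then show ?thesis
      using False active_activation[OF True] by (simp add: rate_eq adjacent_def)
  qed (use False in \<open>simp add: rate_eq adjacent_def\<close>)
qed

lemma finite_state_set: "finite (states N C E)"
  by (rule finite_subset[of _ "{1..N} \<rightarrow>\<^sub>E {0..C}"]) (auto simp: states_def intro: finite_PiE)

lemma deactivate_in_states:
  assumes "x \<in> states N C E" "i \<in> {1..N}"
  shows "x(i := 0) \<in> states N C E"
proof -
  have "\<not> ((x(i := 0)) j = c \<and> (x(i := 0)) k = c)" if "c \<in> {1..C}" "(j, k) \<in> E c" for c j k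
  proof -
    have "\<not> (x j = c \<and> x k = c)"
      using that assms(1) by (auto simp: states_def)
    then show ?thesis
      using that(1) by (cases "j = i"; cases "k = i") simp_all
  qed
  moreover have "x(i := 0) \<in> {1..N} \<rightarrow>\<^sub>E {0..C}"
    using assms PiE_fun_upd[of 0 "\<lambda>_. {0..C}" i x "{1..N}"] by (simp add: states_def insert_absorb)
  ultimately show ?thesis
    unfolding states_def by (intro CollectI conjI ballI) (blast, clarify, blast)
qed

text \<open>Switching off the active nodes one at a time never creates a conflict, so the idle state
  serves as a hub for all states.\<close>

lemma connected_to_zero:
  assumes "x \<in> states N C E"
  shows "(x, \<lambda>i\<in>{1..N}. 0) \<in> {(u, v). u \<in> states N C E \<and> v \<in> states N C E \<and> adjacent u v}\<^sup>*"
  using assms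
proof (induction "active N x" arbitrary: x)
  case 0
  then have "x i = 0" if "i \<in> {1..N}" for i
    using that by (simp add: active_def split: if_splits)
  then have "x = (\<lambda>i\<in>{1..N}. 0)"
    using 0 by (intro extensionalityI[of x "{1..N}"]) (auto simp: states_def PiE_iff)
  then show ?case
    by simp
next
  case (Suc n)
  have "\<exists>i\<in>{1..N}. x i \<noteq> 0"
  proof (rule ccontr)
    assume "\<not> ?thesis"
    then have "active N x = 0"
      by (simp add: active_def)
    then show False
      using Suc.hyps(2) by simp
  qed
  then obtain i where i: "i \<in> {1..N}" "x i \<noteq> 0"
    by blast
  have xi: "x i \<in> {1..C}"
    using Suc.prems i by (auto simp: states_def PiE_iff Suc_le_eq)
  have "(x(i := 0))(i := x i) = x"
    by simp
  then have act: "activation (x(i := 0)) x"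
    using i xi unfolding activation_def by (intro bexI[of _ i] bexI[of _ "x i"]) auto
  then have "n = active N (x(i := 0))"
    using active_activation[OF act] Suc.hyps(2) by simp
  then have "(x(i := 0), \<lambda>i\<in>{1..N}. 0) \<in> {(u, v). u \<in> states N C E \<and> v \<in> states N C E \<and> adjacent u v}\<^sup>*"
    using Suc.hyps(1) deactivate_in_states[OF Suc.prems i(1)] by blast
  moreover have "(x, x(i := 0)) \<in> {(u, v). u \<in> states N C E \<and> v \<in> states N C E \<and> adjacent u v}"
    using act Suc.prems deactivate_in_states[OF Suc.prems i(1)] by (auto simp: adjacent_def)
  ultimately show ?case
    by (rule converse_rtrancl_into_rtrancl[rotated])
qed

lemma states_connected:
  assumes "x \<in> states N C E" "y \<in> states N C E"
  shows "(x, y) \<in> {(u, v). u \<in> states N C E \<and> v \<in> states N C E \<and> adjacent u v}\<^sup>*"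
proof -
  have "sym {(u, v). u \<in> states N C E \<and> v \<in> states N C E \<and> adjacent u v}"
    by (auto simp: sym_def adjacent_def)
  then have "((\<lambda>i\<in>{1..N}. 0), y) \<in> {(u, v). u \<in> states N C E \<and> v \<in> states N C E \<and> adjacent u v}\<^sup>*"
    using connected_to_zero[OF assms(2)] by (meson sym_rtrancl symD)
  then show ?thesis
    using connected_to_zero[OF assms(1)] by (rule rtrancl_trans[rotated])
qed

lemma reversible_rates_states:
  assumes "1 < \<nu>"
  shows "reversible_rates (states N C E) (rate N C \<nu>) (\<lambda>x. \<nu> ^ active N x)"
proof
  show "finite (states N C E)"
    by (rule finite_state_set)
  show "0 \<le> rate N C \<nu> x y" for x y
    using assms by (simp add: rate_eq)
  show "0 < \<nu> ^ active N x" for x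
    using assms by simp
  show "\<nu> ^ active N x * rate N C \<nu> x y = \<nu> ^ active N y * rate N C \<nu> y x" for x y
    using assms by (auto simp: conductance_eq adjacent_def max.commute)
  show "(x, y) \<in> {(u, v). u \<in> states N C E \<and> v \<in> states N C E \<and> 0 < rate N C \<nu> u v}\<^sup>*"
    if "x \<in> states N C E" "y \<in> states N C E" for x y
    using states_connected[OF that] by (simp add: rate_pos_iff_adjacent[OF assms])
qed

section \<open>Paths and communication heights\<close>

lemma paths_iff:
  "p \<in> paths N C E x y \<longleftrightarrow> p \<noteq> [] \<and> set p \<subseteq> states N C E \<and> hd p = x \<and> last p = y \<and> successively adjacent p"
proof -
  have "(\<forall>\<nu>>1. 0 < rate N C \<nu> u v) \<longleftrightarrow> adjacent u v" for u v
    using rate_pos_iff_adjacent[of 2 u v] rate_pos_iff_adjacent[of _ u v]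
    by (meson one_less_numeral_iff semiring_norm(76))
  then show ?thesis
    by (simp add: paths_def)
qed

text \<open>\<open>Q\<close> is demanded only of states that are entered, so the start is exempt and
  needs no assumption.\<close>

lemma rtrancl_imp_path:
  assumes "(x, y) \<in> {(u, v). u \<in> states N C E \<and> v \<in> states N C E \<and> adjacent u v \<and> Q v}\<^sup>*"
    and "x \<in> states N C E"
  obtains p where "p \<in> paths N C E x y" "\<And>z. z \<in> set p \<Longrightarrow> z = x \<or> Q z"
proof -
  from assms(1) have "\<exists>p\<in>paths N C E x y. \<forall>z\<in>set p. z = x \<or> Q z"
  proof (induction rule: rtrancl_induct)
    case base
    show ?case
      using assms(2) by (intro bexI[of _ "[x]"]) (auto simp: paths_iff)
  next
    case (step y z)
    then obtain p where "p \<in> paths N C E x y" "\<forall>z\<in>set p. z = x \<or> Q z"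
      by blast
    then show ?case
      using step(2) by (intro bexI[of _ "p @ [z]"]) (auto simp: paths_iff successively_append_iff)
  qed
  then show thesis
    using that by blast
qed

lemma active_le_max_active: "x \<in> states N C E \<Longrightarrow> active N x \<le> max_active N C E"
  unfolding max_active_def using finite_state_set by (intro Max_ge) auto

abbreviation deficit :: "(nat \<Rightarrow> nat) \<Rightarrow> nat" where
  "deficit z \<equiv> max_active N C E - active N z"

text \<open>Paths may revisit states, so there can be infinitely many, but their heights are
  bounded. This makes the \<open>Min\<close> in \<open>comm_height\<close> a genuine
  minimum.\<close>

lemma path_heights:
  assumes "x \<in> states N C E" "y \<in> states N C E"
  defines "H \<equiv> (\<lambda>\<omega>. Max (deficit ` set \<omega>)) ` paths N C E x y"
  shows "finite H" "H \<noteq> {}"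
proof -
  have "Max (deficit ` set p) \<le> max_active N C E" if "p \<in> paths N C E x y" for p
    using that by (subst Max_le_iff) (auto simp: paths_iff)
  then have "H \<subseteq> {..max_active N C E}"
    by (auto simp: H_def)
  then show "finite H"
    by (rule finite_subset) simp
  have "(x, y) \<in> {(u, v). u \<in> states N C E \<and> v \<in> states N C E \<and> adjacent u v \<and> True}\<^sup>*"
    using states_connected[OF assms(1,2)] by simp
  then obtain p where "p \<in> paths N C E x y"
    by (rule rtrancl_imp_path[OF _ assms(1)])
  then show "H \<noteq> {}"
    by (auto simp: H_def)
qed

context
  fixes s and D
  assumes s: "s \<in> states N C E" and D: "D \<subseteq> states N C E" "D \<noteq> {}"
begin

lemma finite_targets: "finite D"
  using D(1) finite_state_set by (rule finite_subset)

lemma comm_height_set_attained: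
  obtains d p where "d \<in> D" "p \<in> paths N C E s d" "\<And>z. z \<in> set p \<Longrightarrow> deficit z \<le> comm_height_set N C E s D"
proof -
  have "comm_height_set N C E s D \<in> comm_height N C E s ` D"
    unfolding comm_height_set_def using finite_targets D by (intro Min_in) auto
  then obtain d where d: "d \<in> D" "comm_height_set N C E s D = comm_height N C E s d"
    by auto
  have "comm_height N C E s d \<in> (\<lambda>\<omega>. Max (deficit ` set \<omega>)) ` paths N C E s d"
    unfolding comm_height_def using path_heights[OF s, of d] d D by (intro Min_in) auto
  then obtain p where p: "p \<in> paths N C E s d" "comm_height N C E s d = Max (deficit ` set p)"
    by auto
  show thesis
    using d p by (intro that[of d p]) auto
qed

lemma comm_height_set_le:
  assumes "d \<in> D" "p \<in> paths N C E s d"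
  obtains z where "z \<in> set p" "comm_height_set N C E s D \<le> deficit z"
proof -
  have "comm_height_set N C E s D \<le> comm_height N C E s d"
    unfolding comm_height_set_def using finite_targets assms by (intro Min_le) auto
  also have "\<dots> \<le> Max (deficit ` set p)"
    unfolding comm_height_def using path_heights[OF s, of d] assms D by (intro Min_le) auto
  finally have "comm_height_set N C E s D \<le> Max (deficit ` set p)" .
  moreover have "Max (deficit ` set p) \<in> deficit ` set p"
    using assms(2) by (intro Max_in) (auto simp: paths_iff)
  ultimately show thesis
    using that by auto
qed

end

end

section \<open>Bottleneck conductance between dominant states\<close>

context
  fixes N C :: nat and E :: "nat \<Rightarrow> (nat \<times> nat) set" and s :: "nat \<Rightarrow> nat" and D :: "(nat \<Rightarrow> nat) set"
  assumes s: "s \<in> dominant N C E" and D: "D \<subseteq> dominant N C E - {s}" "D \<noteq> {}"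
begin

lemma s_in_states: "s \<in> states N C E" and D_subset_states: "D \<subseteq> states N C E" and s_notin_D: "s \<notin> D"
  and active_s: "active N s = max_active N C E"
  using s D by (auto simp: dominant_def)

text \<open>Ensures that the natural subtraction in \<open>bottleneck\<close> does not
  truncate.\<close>

lemma comm_height_set_le_max_active: "comm_height_set N C E s D \<le> max_active N C E"
proof -
  obtain d p where "d \<in> D" "p \<in> paths N C E s d"
    using comm_height_set_attained[OF s_in_states D_subset_states \<open>D \<noteq> {}\<close>] by blast
  then obtain z where "comm_height_set N C E s D \<le> max_active N C E - active N z"
    using comm_height_set_le[OF s_in_states D_subset_states \<open>D \<noteq> {}\<close>] by blast
  then show ?thesis
    by simp
qed

text \<open>
  Adjacent states differ by one active node, so an edge at a lowest state of an optimal path has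
  conductance \<open>\<nu> ^ bottleneck\<close>.
\<close>

definition bottleneck :: nat where
  "bottleneck = max_active N C E - comm_height_set N C E s D + 1"

lemma weight_bottleneck_ratio:
  assumes "1 < \<nu>"
  shows "\<nu> ^ active N s / \<nu> ^ bottleneck = \<nu> powr (real (comm_height_set N C E s D) - 1)"
proof -
  have "\<nu> ^ active N s / \<nu> ^ bottleneck = \<nu> powr (real (max_active N C E) - real bottleneck)"
    using assms by (simp add: active_s powr_diff powr_realpow)
  also have "real (max_active N C E) - real bottleneck = real (comm_height_set N C E s D) - 1"
    using comm_height_set_le_max_active by (simp add: bottleneck_def of_nat_diff)
  finally show ?thesis .
qed

text \<open>An optimal path depends on the conflict graphs alone, so \<open>b\<close> can be fixed
  before \<nu>.\<close>

lemma mean_hitting_time_upper_bound: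
  obtains b where "0 < b"
    "\<And>\<nu> h. 1 < \<nu> \<Longrightarrow> (\<And>x. x \<in> D \<Longrightarrow> h x = 0) \<Longrightarrow>
      (\<And>x. x \<in> states N C E - D \<Longrightarrow> reversible_rates.gen (states N C E) (rate N C \<nu>) h x = - 1) \<Longrightarrow>
      h s \<le> b * \<nu> powr (real (comm_height_set N C E s D) - 1)"
proof -
  obtain d p where d: "d \<in> D" and p: "p \<in> paths N C E s d"
    and height: "\<And>z. z \<in> set p \<Longrightarrow> max_active N C E - active N z \<le> comm_height_set N C E s D"
    using comm_height_set_attained[OF s_in_states D_subset_states \<open>D \<noteq> {}\<close>] by blast
  have p': "p \<noteq> []" "set p \<subseteq> states N C E" "hd p = s" "last p = d" "successively (adjacent N C) p"
    using p by (auto simp: paths_iff)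
  define b where "b = 2 * real (card (states N C E)) * (real (length p))\<^sup>2"
  show thesis
  proof (rule that[of b])
    show "0 < b"
      using p'(1) s_in_states finite_state_set[of N C E] by (auto simp: b_def card_gt_0_iff zero_less_mult_iff)
    fix \<nu> :: real and h
    assume \<nu>: "1 < \<nu>" and h: "\<And>x. x \<in> D \<Longrightarrow> h x = 0"
      "\<And>x. x \<in> states N C E - D \<Longrightarrow> reversible_rates.gen (states N C E) (rate N C \<nu>) h x = - 1"
    interpret reversible_rates "states N C E" "rate N C \<nu>" "\<lambda>x. \<nu> ^ active N x"
      using \<nu> by (rule reversible_rates_states)
    have "successively (\<lambda>u v. \<nu> ^ bottleneck \<le> \<nu> ^ active N u * rate N C \<nu> u v) p"
    proof (rule successively_mono[OF p'(5)])
      fix u v assume uv: "u \<in> set p" "v \<in> set p" "adjacent N C u v"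
      \<comment> \<open>Neither endpoint lies below the communication height, and their activities
        differ by one, so the busier endpoint lies at least one above that level.\<close>
      then have "bottleneck \<le> max (active N u) (active N v)"
        using height[of u] height[of v] active_adjacent[OF uv(3)] unfolding bottleneck_def by arith
      then show "\<nu> ^ bottleneck \<le> \<nu> ^ active N u * rate N C \<nu> u v"
        using \<nu> uv by (simp add: conductance_eq)
    qed
    moreover have "\<nu> ^ active N x \<le> \<nu> ^ active N s" if "x \<in> states N C E" for x
      using \<nu> active_le_max_active[OF that] by (simp add: active_s)
    ultimately have "h s \<le> b * (\<nu> ^ active N s / \<nu> ^ bottleneck)"
      unfolding b_def using \<nu> p' d s_in_states s_notin_D
      by (intro mean_hitting_time_upper[OF \<open>D \<noteq> {}\<close> D_subset_states _ h]) auto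
    then show "h s \<le> b * \<nu> powr (real (comm_height_set N C E s D) - 1)"
      by (simp only: weight_bottleneck_ratio[OF \<nu>])
  qed
qed

lemma mean_hitting_time_lower_bound:
  assumes \<nu>: "1 < \<nu>" and h: "\<And>x. x \<in> D \<Longrightarrow> h x = 0"
    "\<And>x. x \<in> states N C E - D \<Longrightarrow> reversible_rates.gen (states N C E) (rate N C \<nu>) h x = - 1"
  shows "\<nu> powr (real (comm_height_set N C E s D) - 1) \<le> (real (card (states N C E)))\<^sup>2 * h s"
proof -
  let ?low = "\<lambda>v. max_active N C E - active N v < comm_height_set N C E s D"
  let ?R = "{(u, v). u \<in> states N C E \<and> v \<in> states N C E \<and> adjacent N C u v \<and> ?low v}"
  \<comment> \<open>The part reachable from \<open>s\<close> through states strictly above the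
    bottleneck level; a dominant target inside it would give a path below the communication
    height.\<close>
  define U where "U = {x. (s, x) \<in> ?R\<^sup>*}"
  have "d \<notin> U" if "d \<in> D" for d
  proof
    assume "d \<in> U"
    then obtain p where p: "p \<in> paths N C E s d" "\<And>z. z \<in> set p \<Longrightarrow> z = s \<or> ?low z"
      using rtrancl_imp_path[of s d N C E ?low] s_in_states by (auto simp: U_def)
    have d: "d \<in> set p" "d \<noteq> s" "active N d = max_active N C E"
      using p(1) that D by (auto simp: paths_iff dominant_def)
    \<comment> \<open>The start is exempt from \<open>?low\<close>. As \<open>d\<close> differs from
      \<open>s\<close> it was entered, and with deficit 0 it shows the height to be positive, so
      \<open>s\<close> satisfies \<open>?low\<close> as well.\<close>
    then have "0 < comm_height_set N C E s D"
      using p(2)[of d] by simp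
    then have "?low z" if "z \<in> set p" for z
      using p(2)[OF that] active_s by auto
    moreover obtain z where "z \<in> set p" "comm_height_set N C E s D \<le> max_active N C E - active N z"
      using comm_height_set_le[OF s_in_states D_subset_states \<open>D \<noteq> {}\<close> \<open>d \<in> D\<close> p(1)] by blast
    ultimately show False
      by fastforce
  qed
  then have "U \<inter> D = {}"
    by blast
  interpret reversible_rates "states N C E" "rate N C \<nu>" "\<lambda>x. \<nu> ^ active N x"
    using \<nu> by (rule reversible_rates_states)
  have cut: "\<nu> ^ active N x * rate N C \<nu> x y \<le> \<nu> ^ bottleneck"
    if "x \<in> states N C E \<inter> U" "y \<in> states N C E - U" for x y
  proof (cases "adjacent N C x y")
    case True
    have "\<not> ?low y"
    proof
      assume "?low y"
      then have "(x, y) \<in> ?R"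
        using True that by blast
      then show False
        using that unfolding U_def by (blast intro: rtrancl_into_rtrancl)
    qed
    \<comment> \<open>An edge leaving \<open>U\<close> ends in a state with deficit at least the
      communication height, and \<open>x\<close> has at most one more active node than that
      state.\<close>
    then have "max (active N x) (active N y) \<le> bottleneck"
      using active_adjacent[OF True] active_le_max_active[of y N C E] comm_height_set_le_max_active that(2)
      unfolding bottleneck_def by auto
    then show ?thesis
      using \<nu> True by (simp add: conductance_eq)
  qed (use \<nu> in \<open>simp add: conductance_eq\<close>)
  have "\<nu> ^ active N s / \<nu> ^ bottleneck \<le> (real (card (states N C E)))\<^sup>2 * h s"
    by (rule mean_hitting_time_lower[OF \<open>D \<noteq> {}\<close> D_subset_states _ h _ _ \<open>U \<inter> D = {}\<close> cut])
      (use \<nu> s_in_states s_notin_D in \<open>auto simp: U_def\<close>)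
  then show ?thesis
    by (simp only: weight_bottleneck_ratio[OF \<nu>])
qed

end

text \<open>The first conjunct rules out default values: \<open>enn2real\<close> maps infinity to 0,
  so positivity and finiteness ensure that the logarithm is that of the true mean.\<close>

theorem theorem5p1:
  fixes N C :: nat
    and E :: "nat \<Rightarrow> (nat \<times> nat) set"
    and s :: "nat \<Rightarrow> nat"
    and D :: "(nat \<Rightarrow> nat) set"
    and M :: "real \<Rightarrow> 'w measure"
    and X :: "real \<Rightarrow> real \<Rightarrow> 'w \<Rightarrow> nat \<Rightarrow> nat"
  assumes "1 \<le> C"
    and "\<And>c. c \<in> {1..C} \<Longrightarrow> simple_graph_on {1..N} (E c)"
    and "s \<in> dominant N C E"
    and "D \<subseteq> dominant N C E - {s}" and "D \<noteq> {}"
    and "\<And>\<nu>. 1 < \<nu> \<Longrightarrow> markov_jump_process (M \<nu>) (X \<nu>) (states N C E) (rate N C \<nu>)"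
    and "\<And>\<nu>. 1 < \<nu> \<Longrightarrow> AE \<omega> in M \<nu>. X \<nu> 0 \<omega> = s"
  shows "(\<forall>\<^sub>F \<nu> in at_top. 0 < (\<integral>\<^sup>+\<omega>. hitting_time (X \<nu>) D \<omega> \<partial>M \<nu>) \<and>
                        (\<integral>\<^sup>+\<omega>. hitting_time (X \<nu>) D \<omega> \<partial>M \<nu>) < \<infinity>) \<and>
         ((\<lambda>\<nu>. log \<nu> (enn2real (\<integral>\<^sup>+\<omega>. hitting_time (X \<nu>) D \<omega> \<partial>M \<nu>)))
            \<longlongrightarrow> real (comm_height_set N C E s D) - 1) at_top"
proof -
  let ?S = "states N C E" and ?e = "real (comm_height_set N C E s D) - 1"
  \<comment> \<open>The reciprocal of the constant in the lower bound; like \<open>b\<close> below,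
    it is fixed before \<nu>.\<close>
  define a where "a = 1 / (real (card ?S))\<^sup>2"
  have s: "s \<in> ?S - D" and D: "D \<subseteq> ?S"
    using assms(3,4) by (auto simp: dominant_def)
  then have card: "0 < card ?S"
    using finite_state_set[of N C E] by (auto simp: card_gt_0_iff)
  then have "0 < a"
    by (simp add: a_def)
  obtain b where "0 < b" and upper: "\<And>\<nu> h. 1 < \<nu> \<Longrightarrow> (\<And>x. x \<in> D \<Longrightarrow> h x = 0) \<Longrightarrow>
      (\<And>x. x \<in> ?S - D \<Longrightarrow> reversible_rates.gen ?S (rate N C \<nu>) h x = - 1) \<Longrightarrow> h s \<le> b * \<nu> powr ?e"
    by (rule mean_hitting_time_upper_bound[OF assms(3-5)]) blast
  have "\<exists>m. (\<integral>\<^sup>+\<omega>. hitting_time (X \<nu>) D \<omega> \<partial>M \<nu>) = ennreal m \<and> a * \<nu> powr ?e \<le> m \<and> m \<le> b * \<nu> powr ?e"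
    if \<nu>: "1 < \<nu>" for \<nu>
  proof -
    interpret reversible_rates ?S "rate N C \<nu>" "\<lambda>x. \<nu> ^ active N x"
      using \<nu> by (rule reversible_rates_states)
    interpret markov_jump_process "M \<nu>" "X \<nu>" ?S "rate N C \<nu>"
      using \<nu> by (rule assms(6))
    obtain h where h: "\<And>x. x \<in> D \<Longrightarrow> h x = 0" "\<And>x. x \<in> ?S - D \<Longrightarrow> gen h x = - 1"
      by (rule poisson_solvable[OF assms(5) D, of "\<lambda>_. 1"]) blast
    have "0 \<le> h x" if "x \<in> ?S" for x
      using assms(5) D h that by (rule mean_hitting_time_nonneg)
    then have "(\<integral>\<^sup>+\<omega>. hitting_time (X \<nu>) D \<omega> \<partial>M \<nu>) = ennreal (h s)"
      using h(2)[unfolded gen_def]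
      by (intro nn_integral_hitting_time[OF D assms(7)[OF \<nu>] s h(1)])
    moreover have "a * \<nu> powr ?e \<le> h s"
      using mean_hitting_time_lower_bound[OF assms(3-5) \<nu> h] card
      by (simp add: a_def field_simps)
    moreover have "h s \<le> b * \<nu> powr ?e"
      by (rule upper[OF \<nu> h])
    ultimately show ?thesis
      by blast
  qed
  then obtain m where m: "\<And>\<nu>. 1 < \<nu> \<Longrightarrow> (\<integral>\<^sup>+\<omega>. hitting_time (X \<nu>) D \<omega> \<partial>M \<nu>) = ennreal (m \<nu>)"
    and m_lower: "\<And>\<nu>. 1 < \<nu> \<Longrightarrow> a * \<nu> powr ?e \<le> m \<nu>"
    and m_upper: "\<And>\<nu>. 1 < \<nu> \<Longrightarrow> m \<nu> \<le> b * \<nu> powr ?e"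
    by metis
  have m_pos: "0 < m \<nu>" if "1 < \<nu>" for \<nu>
  proof -
    have "0 < a * \<nu> powr ?e"
      using that \<open>0 < a\<close> by simp
    then show ?thesis
      using m_lower[OF that] by linarith
  qed
  show ?thesis
  proof
    show "\<forall>\<^sub>F \<nu> in at_top. 0 < (\<integral>\<^sup>+\<omega>. hitting_time (X \<nu>) D \<omega> \<partial>M \<nu>) \<and>
        (\<integral>\<^sup>+\<omega>. hitting_time (X \<nu>) D \<omega> \<partial>M \<nu>) < \<infinity>"
      using eventually_gt_at_top[of 1] by eventually_elim (simp add: m m_pos)
    have "((\<lambda>\<nu>. log \<nu> (m \<nu>)) \<longlongrightarrow> ?e) at_top"
      using \<open>0 < a\<close> \<open>0 < b\<close> m_lower m_upper by (rule log_tendsto_exponent)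
    moreover have "\<forall>\<^sub>F \<nu> in at_top. log \<nu> (m \<nu>) =
        log \<nu> (enn2real (\<integral>\<^sup>+\<omega>. hitting_time (X \<nu>) D \<omega> \<partial>M \<nu>))"
      using eventually_gt_at_top[of 1] by eventually_elim (simp add: m less_imp_le[OF m_pos])
    ultimately show "((\<lambda>\<nu>. log \<nu> (enn2real (\<integral>\<^sup>+\<omega>. hitting_time (X \<nu>) D \<omega> \<partial>M \<nu>))) \<longlongrightarrow> ?e) at_top"
      by (rule Lim_transform_eventually)
  qed
qed

end
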